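(* Assume that the family of conformity scores $\mathfrak{C}$ is stable, that the sequence $(\mathcal{C}_n(t_{n+1},\mathcal{T}_n))_{n\in\mathbb{N}}$ is stochastically bounded, and that the continuous case assumption CC is fulfilled. Then the non-inflated full conformal prediction sets are asymptotically uniformly conditionally valid, that is, $$\lim_{n\to\infty}\mathbb{E}\Big(\sup_{\alpha\in[0,1]}\big|\mathbb{P}(y_{n+1}\notin PS^{\mathrm{fc}}_{n,\alpha}(0)\,\|\,\mathcal{T}_n)-\alpha\big|\Big)=0 .$$
   Context: Setting. For every $n\in\mathbb{N}$, $P_n$ is a regular Borel probability measure on $\mathcal{Z}_n=\mathcal{Y}_n\times\mathcal{X}_n$, where $\mathcal{Y}_n\subseteq\mathbb{R}$ is a (possibly unbounded) interval and $\mathcal{X}_n$ is a Euclidean space of dimension $p_n\in\mathbb{N}$. For each $n$, $t_i=t_i^{(n)}=(y_i,x_i)$, $1\le i\le n+1$, are i.i.d. with distribution $P_n$ (which may depend on $n$). Put $\mathcal{T}_n=(t_1,\dots,t_n)$, and let $\mathcal{T}_n^{\setminus i}$ denote $\mathcal{T}_n$ with $t_i$ removed. $\mathbb{P}(\cdot\,\|\,\mathcal{T}_n)$ denotes conditional probability given $\mathcal{T}_n$. Conformity scores. $\mathfrak{C}=(\mathcal{C}^{(n)}_m)_{n,m\in\mathbb{N}}$ is a family of measurable functions $\mathcal{C}^{(n)}_m:\mathcal{Z}_n\times\mathcal{Z}_n^m\to\mathbb{R}$ that are symmetric in their second argument (invariant under permutations of the $m$ entries); the superscript $(n)$ is dropped.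 $\mathfrak{C}$ is called stable if $|\mathcal{C}_n(t_{n+1},\mathcal{T}_n)-\mathcal{C}_{n-1}(t_{n+1},\mathcal{T}_n^{\setminus n})|\to 0$ in probability as $n\to\infty$. Continuous case assumption (CC): for every $n\in\mathbb{N}$ and almost every $\mathcal{T}_n$, the distribution of $\mathcal{C}_n(t_{n+1},\mathcal{T}_n)$ conditional on $\mathcal{T}_n$ is absolutely continuous with density $f_{\mathcal{T}_n}$, and the sequence of random variables $(\|f_{\mathcal{T}_n}\|_\infty)_{n\in\mathbb{N}}$ is stochastically bounded, where $\|f\|_\infty=\sup_{x}|f(x)|$. Quantiles. For a cdf $F$ and $\alpha\in\mathbb{R}$, $F^{-1}(\alpha)=\inf\{x\in\mathbb{R}:F(x)\ge\alpha\}\in[-\infty,\infty]$ with $\inf\emptyset=+\infty$. Full conformal prediction sets. For $y\in\mathcal{Y}_n$ let $\mathcal{D}_{n+1}^y=(t_1,\dots,t_n,(y,x_{n+1}))$ and, for $s\in\mathbb{R}$, $$\hat F_y(s)=\frac{1}{n+1}\mathds{1}\{\mathcal{C}_n((y,x_{n+1}),\mathcal{T}_n)\le s\}+\frac1{n+1}\sum_{i=1}^n\mathds{1}\{\mathcal{C}_n(t_i,\mathcal{D}_{n+1}^y\setminus t_i)\le s\},$$ where $\mathcal{D}_{n+1}^y\setminus t_i$ is $\mathcal{D}_{n+1}^y$ with its $i$-th entry removed. For $\alpha,\delta\in\mathbb{R}$, $$PS^{\mathrm{fc}}_{n,\alpha}(\delta)=\{y\in\mathcal{Y}_n:\mathcal{C}_n((y,x_{n+1}),\mathcal{T}_n)\le\hat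 F_y^{-1}(1-\alpha)+\delta\},$$ where $c\le+\infty$ is true and $c\le-\infty$ is false for real $c$. *)

theory Defs
  imports "HOL-Probability.Probability" "HOL-Combinatorics.Permutations"
begin

text \<open>
  The dimension of the feature space varies with \<open>n\<close>, so a vector in \<open>\<real>\<^sup>p\<close> is an extensional
  function on \<open>{..<p}\<close>; the product of the Borel sigma-algebras is the Borel sigma-algebra of
  \<open>\<real>\<^sup>p\<close>. An observation is a pair \<open>(y, x)\<close>, and an \<open>m\<close>-tuple of observations is an extensional
  function on \<open>{1..m}\<close>.
\<close>

type_synonym obs = "real \<times> (nat \<Rightarrow> real)"

definition obs_space :: "real set \<Rightarrow> nat \<Rightarrow> obs measure" where
  "obs_space Y p = restrict_space borel Y \<Otimes>\<^sub>M (\<Pi>\<^sub>M i\<in>{..<p}. borel)"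

definition tuple_space :: "nat \<Rightarrow> 'b measure \<Rightarrow> (nat \<Rightarrow> 'b) measure" where
  "tuple_space m Z = (\<Pi>\<^sub>M i\<in>{1..m}. Z)"

definition tuple :: "nat \<Rightarrow> (nat \<Rightarrow> 'a \<Rightarrow> 'b) \<Rightarrow> 'a \<Rightarrow> (nat \<Rightarrow> 'b)" where
  "tuple m t \<omega> = (\<lambda>i\<in>{1..m}. t i \<omega>)"

text \<open>The \<open>i\<close>-th entry is removed and the later entries move down; the result has length \<open>m\<close>.\<close>

definition remove_entry :: "nat \<Rightarrow> nat \<Rightarrow> (nat \<Rightarrow> 'b) \<Rightarrow> (nat \<Rightarrow> 'b)" where
  "remove_entry m i D = (\<lambda>j\<in>{1..m}. if j < i then D j else D (j + 1))"

definition iid :: "'a measure \<Rightarrow> 'b measure \<Rightarrow> nat set \<Rightarrow> (nat \<Rightarrow> 'a \<Rightarrow> 'b) \<Rightarrow> bool" where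
  "iid M P I t \<longleftrightarrow>
     prob_space.indep_vars M (\<lambda>_. P) t I \<and> (\<forall>i\<in>I. distr M P (t i) = P)"

text \<open>
  A regular version of the conditional distribution of \<open>V\<close> (with values in \<open>N\<close>) given \<open>X\<close>
  (with values in \<open>S\<close>). The supremum over \<open>\<alpha>\<close> of conditional probabilities only makes sense for
  such a version, since a conditional probability of a single event is defined up to null sets.
\<close>

definition regular_cond_distr ::
  "'a measure \<Rightarrow> 'b measure \<Rightarrow> ('a \<Rightarrow> 'b) \<Rightarrow> 'c measure \<Rightarrow> ('a \<Rightarrow> 'c) \<Rightarrow> ('b \<Rightarrow> 'c measure) \<Rightarrow> bool"
where
  "regular_cond_distr M S X N V K \<longleftrightarrow>
     K \<in> S \<rightarrow>\<^sub>M prob_algebra N \<and>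
     (\<forall>A\<in>sets N. AE \<omega> in M.
        measure (K (X \<omega>)) A =
        real_cond_exp M (vimage_algebra (space M) X S) (\<lambda>\<omega>. indicator A (V \<omega>)) \<omega>)"

definition conformity_scores ::
  "(nat \<Rightarrow> 'b measure) \<Rightarrow> (nat \<Rightarrow> nat \<Rightarrow> 'b \<Rightarrow> (nat \<Rightarrow> 'b) \<Rightarrow> real) \<Rightarrow> bool" where
  "conformity_scores Z C \<longleftrightarrow>
     (\<forall>n\<ge>1. \<forall>m\<ge>1.
        (\<lambda>(z, D). C n m z D) \<in> borel_measurable (Z n \<Otimes>\<^sub>M tuple_space m (Z n)) \<and>
        (\<forall>z\<in>space (Z n). \<forall>D\<in>space (tuple_space m (Z n)). \<forall>\<pi>. \<pi> permutes {1..m} \<longrightarrow>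
           C n m z (D \<circ> \<pi>) = C n m z D))"

text \<open>
  Only the joint law of \<open>t n 1, ..., t n (n + 1)\<close> for each fixed \<open>n\<close> matters, so the \<open>n\<close>-th random
  variable of a sequence may live on its own probability space \<open>M n\<close>. Sequences start at \<open>n = 1\<close>.
\<close>

definition tends_to_0_in_probability ::
  "(nat \<Rightarrow> 'a measure) \<Rightarrow> (nat \<Rightarrow> 'a \<Rightarrow> real) \<Rightarrow> bool" where
  "tends_to_0_in_probability M V \<longleftrightarrow>
     (\<forall>\<epsilon>>0. (\<lambda>n. measure (M n) {\<omega> \<in> space (M n). \<bar>V n \<omega>\<bar> > \<epsilon>}) \<longlonglongrightarrow> 0)"

text \<open>
  Stated for the absolute values of a sequence, in \<open>[0, \<infinity>]\<close>, because the supremum norm of a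
  density may be infinite.
\<close>

definition stochastically_bounded ::
  "(nat \<Rightarrow> 'a measure) \<Rightarrow> (nat \<Rightarrow> 'a \<Rightarrow> ennreal) \<Rightarrow> bool" where
  "stochastically_bounded M V \<longleftrightarrow>
     (\<forall>n\<ge>1. V n \<in> borel_measurable (M n)) \<and>
     (\<forall>\<epsilon>>0. \<exists>B::real. \<forall>n\<ge>1. measure (M n) {\<omega> \<in> space (M n). V n \<omega> > ennreal B} \<le> \<epsilon>)"

definition stable_scores ::
  "(nat \<Rightarrow> 'a measure) \<Rightarrow> (nat \<Rightarrow> nat \<Rightarrow> 'a \<Rightarrow> 'b) \<Rightarrow>
   (nat \<Rightarrow> nat \<Rightarrow> 'b \<Rightarrow> (nat \<Rightarrow> 'b) \<Rightarrow> real) \<Rightarrow> bool" where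
  "stable_scores M t C \<longleftrightarrow>
     tends_to_0_in_probability M (\<lambda>n \<omega>.
       C n n (t n (n + 1) \<omega>) (tuple n (t n) \<omega>) -
       C n (n - 1) (t n (n + 1) \<omega>) (remove_entry (n - 1) n (tuple n (t n) \<omega>)))"

text \<open>
  \<open>K n\<close> is a regular version of the conditional distribution of the full sample
  \<open>s = (t\<^sub>1, ..., t\<^sub>n\<^sub>+\<^sub>1)\<close> given its first \<open>n\<close> entries, so the law of
  \<open>C n n (s (n + 1)) (restrict s {1..n})\<close> under it is the conditional law of the score.
\<close>

definition continuous_case ::
  "(nat \<Rightarrow> 'a measure) \<Rightarrow> (nat \<Rightarrow> nat \<Rightarrow> 'a \<Rightarrow> 'b) \<Rightarrow>
   (nat \<Rightarrow> (nat \<Rightarrow> 'b) \<Rightarrow> (nat \<Rightarrow> 'b) measure) \<Rightarrow>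
   (nat \<Rightarrow> nat \<Rightarrow> 'b \<Rightarrow> (nat \<Rightarrow> 'b) \<Rightarrow> real) \<Rightarrow> bool" where
  "continuous_case M t K C \<longleftrightarrow>
     (\<exists>f :: nat \<Rightarrow> (nat \<Rightarrow> 'b) \<Rightarrow> real \<Rightarrow> real.
        (\<forall>n\<ge>1. AE \<omega> in M n.
           (\<forall>x. 0 \<le> f n (tuple n (t n) \<omega>) x) \<and>
           distributed (K n (tuple n (t n) \<omega>)) lborel
             (\<lambda>s. C n n (s (n + 1)) (restrict s {1..n}))
             (\<lambda>x. ennreal (f n (tuple n (t n) \<omega>) x))) \<and>
        stochastically_bounded M (\<lambda>n \<omega>. SUP x. ennreal \<bar>f n (tuple n (t n) \<omega>) x\<bar>))"

definition quantile :: "(real \<Rightarrow> real) \<Rightarrow> real \<Rightarrow> ereal" where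
  "quantile F a = Inf (ereal ` {x. F x \<ge> a})"

text \<open>
  In the next two definitions \<open>T\<close> is an \<open>n\<close>-tuple, \<open>x\<close> is the feature vector of the new observation,
  and \<open>C m\<close> is the conformity score for an \<open>m\<close>-tuple. The augmented sample is \<open>T(n + 1 := (y, x))\<close>.
\<close>

definition Fhat ::
  "(nat \<Rightarrow> obs \<Rightarrow> (nat \<Rightarrow> obs) \<Rightarrow> real) \<Rightarrow> nat \<Rightarrow> (nat \<Rightarrow> obs) \<Rightarrow> (nat \<Rightarrow> real) \<Rightarrow>
   real \<Rightarrow> real \<Rightarrow> real" where
  "Fhat C n T x y s =
     1 / (real n + 1) * of_bool (C n (y, x) T \<le> s) +
     1 / (real n + 1) *
       (\<Sum>i=1..n. of_bool (C n (T i) (remove_entry n i (T(n + 1 := (y, x)))) \<le> s))"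

definition PS_fc ::
  "real set \<Rightarrow> (nat \<Rightarrow> obs \<Rightarrow> (nat \<Rightarrow> obs) \<Rightarrow> real) \<Rightarrow> nat \<Rightarrow> (nat \<Rightarrow> obs) \<Rightarrow> (nat \<Rightarrow> real) \<Rightarrow>
   real \<Rightarrow> real \<Rightarrow> real set" where
  "PS_fc Y C n T x \<alpha> \<delta> =
     {y \<in> Y. ereal (C n (y, x) T) \<le> quantile (Fhat C n T x y) (1 - \<alpha>) + ereal \<delta>}"

text \<open>The event \<open>y\<^sub>n\<^sub>+\<^sub>1 \<notin> PS\<close> in terms of the full sample \<open>s = (t\<^sub>1, ..., t\<^sub>n\<^sub>+\<^sub>1)\<close>.\<close>

definition noncoverage ::
  "obs measure \<Rightarrow> real set \<Rightarrow> (nat \<Rightarrow> obs \<Rightarrow> (nat \<Rightarrow> obs) \<Rightarrow> real) \<Rightarrow> nat \<Rightarrow> real \<Rightarrow> real \<Rightarrow>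
   (nat \<Rightarrow> obs) set" where
  "noncoverage Z Y C n \<alpha> \<delta> =
     {s \<in> space (tuple_space (n + 1) Z).
        fst (s (n + 1)) \<notin> PS_fc Y C n (restrict s {1..n}) (snd (s (n + 1))) \<alpha> \<delta>}"

end

theory Submission
  imports Defs
begin

text \<open>
  Fix \<open>n\<close>, let \<open>t\<^sub>1, ..., t\<^sub>n\<^sub>+\<^sub>1\<close> be the full sample, \<open>T\<close> its first \<open>n\<close> entries, and let \<open>U\<^sub>i\<close> be the
  score of \<open>t\<^sub>i\<close> relative to the \<open>n\<close> other observations. At \<open>y = y\<^sub>n\<^sub>+\<^sub>1\<close> the function \<open>Fhat\<close> is the
  empirical distribution function of \<open>U\<^sub>1, ..., U\<^sub>n\<^sub>+\<^sub>1\<close>, so non-coverage at level \<open>\<alpha>\<close> is the event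
  \<open>G \<ge> 1 - \<alpha>\<close>, where \<open>G\<close> is the number of \<open>i\<close> with \<open>U\<^sub>i < U\<^sub>n\<^sub>+\<^sub>1\<close> divided by \<open>n + 1\<close>
  (\<open>noncoverage_eq\<close>). Let \<open>F\<close> be the conditional distribution function of \<open>U\<^sub>n\<^sub>+\<^sub>1\<close> given \<open>T\<close>. It is
  continuous, so that \<open>W = F(U\<^sub>n\<^sub>+\<^sub>1)\<close> is uniform on \<open>[0, 1]\<close> conditionally on \<open>T\<close>, and then the
  deviation of the conditional law of \<open>G\<close> from uniformity is at most \<open>\<epsilon> + P(\<bar>G - W\<bar> > \<epsilon> | T)\<close>,
  simultaneously in \<open>\<alpha>\<close> (\<open>deviation_le\<close>). By Markov's inequality it remains to show that
  \<open>E (G - W)\<^sup>2 \<rightarrow> 0\<close>.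

  The square is expanded. \<open>E W\<^sup>2 = 1/3\<close> by uniformity, and \<open>E G\<^sup>2 \<le> 1/3\<close> by exchangeability of the
  \<open>U\<^sub>i\<close>, because among three real numbers at most one is strictly above both others
  (\<open>integral_rel_rank_square\<close>). For the mixed term an independent further observation \<open>t\<^sub>n\<^sub>+\<^sub>2\<close> is
  added: up to the factor \<open>n / (n + 1)\<close>, \<open>E G W\<close> is the probability that \<open>U\<^sub>n\<^sub>+\<^sub>1\<close> exceeds both
  \<open>U\<^sub>n\<close> and the score of \<open>t\<^sub>n\<^sub>+\<^sub>2\<close> relative to \<open>T\<close> (\<open>integral_rel_rank_mult_pit\<close>). Permuting
  \<open>t\<^sub>n, t\<^sub>n\<^sub>+\<^sub>1, t\<^sub>n\<^sub>+\<^sub>2\<close> cyclically gives three events of equal probability. Stability says that each of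
  the three observations has nearly the same score relative to \<open>t\<^sub>1, ..., t\<^sub>n\<^sub>-\<^sub>1\<close> together with either
  of the other two; if in addition no two scores nearly coincide, then one of the three events occurs.
  Near ties are unlikely because the conditional density of the scores is stochastically bounded.
  Hence \<open>E G W \<ge> 1/3 - o(1)\<close> (\<open>prob_above_ge\<close>) and \<open>E (G - W)\<^sup>2 \<le> 1/3 + 1/3 - 2/3 + o(1)\<close>.

  The given kernel \<open>K\<close> enters only through countably many events, for each of which it agrees almost
  surely with the kernel that keeps \<open>T\<close> and draws \<open>t\<^sub>n\<^sub>+\<^sub>1\<close> independently (\<open>K_eq_product_kernel\<close>).
\<close>

section \<open>Ranks, maxima of three numbers, and distribution functions\<close>

text \<open>
  The sum counts the index triples with one entry, at a given position, whose value is strictly above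
  the values of both others. The three possible positions give disjoint sets of triples.
\<close>
lemma sum_strict_rank_square_le:
  fixes u :: "'i \<Rightarrow> real"
  assumes "finite I"
  shows "3 * (\<Sum>k\<in>I. (\<Sum>i\<in>I. of_bool (u i < u k))\<^sup>2) \<le> real (card I) ^ 3"
proof -
  define b :: "'i \<Rightarrow> 'i \<Rightarrow> 'i \<Rightarrow> real" where
    "b i j k = of_bool (u i < u k) * of_bool (u j < u k)" for i j k
  let ?S = "\<Sum>k\<in>I. (\<Sum>i\<in>I. of_bool (u i < u k) :: real)\<^sup>2"
  have 1: "?S = (\<Sum>k\<in>I. \<Sum>i\<in>I. \<Sum>j\<in>I. b i j k)"
    by (simp add: b_def power2_eq_square sum_product)
  have 2: "?S = (\<Sum>i\<in>I. \<Sum>k\<in>I. \<Sum>j\<in>I. b i j k)"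
    unfolding 1 by (rule sum.swap)
  then have 3: "?S = (\<Sum>k\<in>I. \<Sum>i\<in>I. \<Sum>j\<in>I. b k j i)" .
  have 4: "?S = (\<Sum>k\<in>I. \<Sum>i\<in>I. \<Sum>j\<in>I. b k i j)"
    unfolding 2 by (rule sum.cong[OF refl], rule sum.swap)
  have "3 * ?S = (\<Sum>k\<in>I. \<Sum>i\<in>I. \<Sum>j\<in>I. b i j k + b k j i + b k i j)"
    using 1 3 4 by (simp add: sum.distrib)
  also have "\<dots> \<le> (\<Sum>k\<in>I. \<Sum>i\<in>I. \<Sum>j\<in>I. 1)"
    by (intro sum_mono) (auto simp: b_def of_bool_def)
  also have "\<dots> = real (card I) ^ 3"
    by (simp add: power3_eq_cube)
  finally show ?thesis .
qed

text \<open>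
  Here \<open>a1, a2\<close> are two versions of one score, both within \<open>\<delta> / 2\<close> of \<open>a\<close>, and likewise for \<open>b\<close> and
  \<open>d\<close>. In each alternative a different item has the larger score in the comparisons with the other
  two. The separation excludes a cyclic outcome of the pairwise comparisons.
\<close>
lemma separated_scores_have_maximum:
  fixes a a1 a2 b b1 b2 d d1 d2 \<delta> :: real
  assumes a: "\<bar>a1 - a\<bar> \<le> \<delta> / 2" "\<bar>a2 - a\<bar> \<le> \<delta> / 2"
    and b: "\<bar>b1 - b\<bar> \<le> \<delta> / 2" "\<bar>b2 - b\<bar> \<le> \<delta> / 2"
    and d: "\<bar>d1 - d\<bar> \<le> \<delta> / 2" "\<bar>d2 - d\<bar> \<le> \<delta> / 2"
    and sep: "\<bar>a2 - b2\<bar> > 2 * \<delta>" "\<bar>a1 - d2\<bar> > 2 * \<delta>" "\<bar>b1 - d1\<bar> > 2 * \<delta>"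
  shows "(a1 < b1 \<and> d1 < b1) \<or> (b2 < d2 \<and> a1 < d2) \<or> (d1 < a2 \<and> b2 < a2)"
proof -
  have "\<bar>a1 - a2\<bar> \<le> \<delta>" using a by linarith
  then have a': "a1 \<le> a2 + \<delta>" "a2 \<le> a1 + \<delta>" by linarith+
  have "\<bar>b1 - b2\<bar> \<le> \<delta>" using b by linarith
  then have b': "b1 \<le> b2 + \<delta>" "b2 \<le> b1 + \<delta>" by linarith+
  have "\<bar>d1 - d2\<bar> \<le> \<delta>" using d by linarith
  then have d': "d1 \<le> d2 + \<delta>" "d2 \<le> d1 + \<delta>" by linarith+
  have \<delta>: "0 \<le> \<delta>" using a' by linarith
  have "a2 + 2 * \<delta> < b2 \<or> b2 + 2 * \<delta> < a2" "a1 + 2 * \<delta> < d2 \<or> d2 + 2 * \<delta> < a1"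
    "b1 + 2 * \<delta> < d1 \<or> d1 + 2 * \<delta> < b1"
    using sep by linarith+
  then consider "a1 < b1" "d1 < b1" | "b2 < d2" "a1 < d2" | "d1 < a2" "b2 < a2"
    using a' b' d' \<delta> by linarith
  then show ?thesis by cases auto
qed

context real_distribution
begin

lemma cdf_measurable [measurable]: "cdf M \<in> borel_measurable borel"
  by (rule borel_measurable_mono) (simp add: mono_def cdf_nondecreasing)

text \<open>The probability integral transform of an atomless law is uniform.\<close>
lemma cdf_uniform:
  assumes na: "\<And>x. measure M {x} = 0"
  shows "distr M borel (cdf M) = uniform_measure lborel {0..1}"
proof -
  have cont: "isCont (cdf M) x" for x
    using na isCont_cdf by simp
  have contU: "continuous_on UNIV (cdf M)"
    using cont by (simp add: continuous_at_imp_continuous_on)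
  interpret D: real_distribution "distr M borel (cdf M)"
    by (rule real_distribution_distr) simp
  interpret U: prob_space "uniform_measure lborel {0..1::real}"
    by (rule prob_space_uniform_measure) auto
  interpret U: real_distribution "uniform_measure lborel {0..1::real}"
    by unfold_locales (auto)
  have inc: "measure M {x. cdf M x \<le> u} = u" if u: "0 < u" "u < 1" for u
  proof -
    have "\<exists>x. cdf M x < u"
      using order_tendstoD(2)[OF cdf_lim_at_bot u(1)] by (auto dest: eventually_happens)
    then obtain a where a: "cdf M a < u" ..
    have "\<exists>x. cdf M x > u"
      using order_tendstoD(1)[OF cdf_lim_at_top_prob u(2)] by (auto dest: eventually_happens)
    then obtain b where b: "u < cdf M b" ..
    have "a \<le> b" using a b cdf_nondecreasing[of b a] by linarith
    define S where "S = {x. cdf M x \<le> u}"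
    have "closed S" unfolding S_def
      by (intro closed_Collect_le contU continuous_on_const)
    have bd: "bdd_above S"
    proof (rule bdd_aboveI)
      fix x assume "x \<in> S"
      then show "x \<le> b" using b cdf_nondecreasing[of b x] by (cases "x \<le> b") (auto simp: S_def)
    qed
    have ne: "S \<noteq> {}" using a by (auto simp: S_def intro: less_imp_le)
    have m: "Sup S \<in> S" using closed_contains_Sup[OF ne bd \<open>closed S\<close>] .
    have S_eq: "S = {..Sup S}"
    proof safe
      fix x assume "x \<in> S" then show "x \<le> Sup S" using bd by (rule cSup_upper)
    next
      fix x assume "x \<le> Sup S" then show "x \<in> S"
        using m cdf_nondecreasing[of x "Sup S"] by (auto simp: S_def)
    qed
    \<comment> \<open>By continuity the value \<open>u\<close> is attained, hence it is attained at \<open>Sup S\<close>.\<close>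
    obtain x0 where x0: "cdf M x0 = u"
      using IVT[of "cdf M" a u b] a b \<open>a \<le> b\<close> cont by auto
    have "x0 \<in> S" using x0 by (simp add: S_def)
    then have "u \<le> cdf M (Sup S)" using S_eq x0 cdf_nondecreasing[of x0 "Sup S"] by auto
    with m have "cdf M (Sup S) = u" by (auto simp: S_def)
    then have "measure M S = u" using S_eq by (simp add: cdf_def)
    then show ?thesis by (simp only: S_def)
  qed
  show ?thesis
  proof (rule cdf_unique)
    show "cdf (distr M borel (cdf M)) = cdf (uniform_measure lborel {0..1})"
    proof
      fix u :: real
      have L: "cdf (distr M borel (cdf M)) u = measure M {x. cdf M x \<le> u}" for u
        by (subst cdf_def, subst measure_distr) (auto simp: vimage_def)
      have R: "cdf (uniform_measure lborel {0..1}) u = measure lborel ({0..1} \<inter> {..u})"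
        by (subst cdf_def, subst measure_uniform_measure) auto
      consider "u \<le> 0" | "0 < u" "u < 1" | "1 \<le> u" by linarith
      then show "cdf (distr M borel (cdf M)) u = cdf (uniform_measure lborel {0..1}) u"
      proof cases
        case 1
        have "measure M {x. cdf M x \<le> u} \<le> e" if "0 < e" for e
        proof -
          define e' where "e' = min e (1/2)"
          have "measure M {x. cdf M x \<le> u} \<le> measure M {x. cdf M x \<le> e'}"
            using that 1 by (intro finite_measure_mono) (auto simp: e'_def)
          also have "\<dots> = e'" using that by (intro inc) (auto simp: e'_def)
          finally show ?thesis by (simp add: e'_def)
        qed
        then have "measure M {x. cdf M x \<le> u} \<le> 0" by (rule field_le_epsilon) simp
        moreover have "measure lborel ({0..1} \<inter> {..u}) = 0"
        proof -
          have "{0..1} \<inter> {..u} \<subseteq> {0::real}" using 1 by auto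
          then have "{0..1} \<inter> {..u} = {} \<or> {0..1} \<inter> {..u} = {0::real}" by (rule subset_singletonD)
          then show ?thesis by (elim disjE) simp_all
        qed
        ultimately show ?thesis using L R by (simp add: measure_le_0_iff)
      next
        case 2
        then have "{0..1} \<inter> {..u} = {0..u}" by auto
        then show ?thesis using L R inc 2 by simp
      next
        case 3
        have "{x. cdf M x \<le> u} = space M" using 3 cdf_bounded_prob by (auto intro: order_trans)
        moreover have "{0..1} \<inter> {..u} = {0..1::real}" using 3 by auto
        ultimately show ?thesis using L R prob_space by simp
      qed
    qed
  qed unfold_locales
qed

lemma integral_cdf_square:
  assumes na: "\<And>x. measure M {x} = 0"
  shows "(\<integral>x. (cdf M x)\<^sup>2 \<partial>M) = 1 / 3"
proof -
  have "(\<integral>x. (cdf M x)\<^sup>2 \<partial>M) = (\<integral>x. x\<^sup>2 \<partial>distr M borel (cdf M))"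
    by (subst integral_distr) auto
  also have "\<dots> = (\<integral>x. x\<^sup>2 \<partial>density lborel (\<lambda>x. ennreal (indicator {0..1} x)))"
    unfolding cdf_uniform[OF na] uniform_measure_def
    by (simp add: ennreal_indicator divide_ennreal_def)
  also have "\<dots> = (\<integral>x. x\<^sup>2 * indicator {0..1} x \<partial>lborel)"
    by (subst integral_density) (auto simp: mult.commute)
  also have "\<dots> = 1 / 3"
    using integral_power[of 0 1 2] by simp
  finally show ?thesis .
qed

lemma measure_cdf_ge:
  assumes na: "\<And>x. measure M {x} = 0" and a: "0 \<le> a" "a \<le> 1"
  shows "measure M {x. a \<le> cdf M x} = 1 - a"
proof -
  have "measure M {x. a \<le> cdf M x} = measure (distr M borel (cdf M)) {a..}"
    by (subst measure_distr) (auto simp: vimage_def)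
  also have "\<dots> = measure lborel ({0..1} \<inter> {a..})"
    unfolding cdf_uniform[OF na] by (subst measure_uniform_measure) auto
  also have "{0..1} \<inter> {a..} = {a..1}"
    using a by auto
  finally show ?thesis
    using a by simp
qed

end

lemma real_distribution_eqI_rat:
  assumes "real_distribution M1" "real_distribution M2"
    and eq: "\<And>q. q \<in> \<rat> \<Longrightarrow> cdf M1 q = cdf M2 q"
  shows "M1 = M2"
proof (rule cdf_unique[OF assms(1,2)])
  interpret M1: real_distribution M1 by fact
  interpret M2: real_distribution M2 by fact
  show "cdf M1 = cdf M2"
  proof (rule ext, rule ccontr)
    fix x assume ne: "cdf M1 x \<noteq> cdf M2 x"
    have "((\<lambda>y. cdf M1 y - cdf M2 y) \<longlongrightarrow> cdf M1 x - cdf M2 x) (at_right x)"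
      using M1.cdf_is_right_cont[of x] M2.cdf_is_right_cont[of x]
      by (intro tendsto_diff) (auto simp: continuous_within)
    from tendsto_imp_eventually_ne[OF this, of 0] ne
    have "eventually (\<lambda>y. cdf M1 y - cdf M2 y \<noteq> 0) (at_right x)" by simp
    then obtain b where b: "b > x" "\<And>y. x < y \<Longrightarrow> y < b \<Longrightarrow> cdf M1 y \<noteq> cdf M2 y"
      by (auto simp: eventually_at_right_field)
    obtain q where "q \<in> \<rat>" "x < q" "q < b" using Rats_dense_in_real[OF b(1)] by auto
    then show False using eq b(2) by blast
  qed
qed

section \<open>Scores of an exchangeable sample\<close>

text \<open>
  A fixed sample size \<open>n\<close>, the law \<open>Q\<close> of one observation, the score \<open>c\<close> relative to \<open>n\<close> observations,
  which is symmetric in them, and the score \<open>c'\<close> relative to \<open>n - 1\<close> observations. All samples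
  are realised canonically as product measures, possibly with more than \<open>n + 1\<close> observations.
\<close>
locale score_sample = prob_space Q for Q :: "'b measure" +
  fixes n :: nat
    and c :: "'b \<Rightarrow> (nat \<Rightarrow> 'b) \<Rightarrow> real"
    and c' :: "'b \<Rightarrow> (nat \<Rightarrow> 'b) \<Rightarrow> real"
  assumes n_pos: "1 \<le> n"
    and c_meas: "(\<lambda>(z, D). c z D) \<in> borel_measurable (Q \<Otimes>\<^sub>M (\<Pi>\<^sub>M i\<in>{1..n}. Q))"
    and c'_meas: "(\<lambda>(z, D). c' z D) \<in> borel_measurable (Q \<Otimes>\<^sub>M (\<Pi>\<^sub>M i\<in>{1..n-1}. Q))"
    and c_sym: "\<And>z D \<pi>. z \<in> space Q \<Longrightarrow> D \<in> space (\<Pi>\<^sub>M i\<in>{1..n}. Q) \<Longrightarrow> \<pi> permutes {1..n} \<Longrightarrow>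
      c z (D \<circ> \<pi>) = c z D"
begin

abbreviation sample :: "nat set \<Rightarrow> (nat \<Rightarrow> 'b) measure" where
  "sample I \<equiv> \<Pi>\<^sub>M i\<in>I. Q"

lemma prob_space_sample: "prob_space (sample I)"
  by (rule prob_space_PiM) unfold_locales

lemma prob_sample_space [simp]: "measure (sample I) (space (sample I)) = 1"
  by (rule prob_space.prob_space[OF prob_space_sample])

lemma integrable_sample_const [simp]: "integrable (sample I) (\<lambda>s. a :: real)"
  by (rule finite_measure.integrable_const) (rule prob_space.finite_measure[OF prob_space_sample])

lemma reindex_measurable:
  assumes "g \<in> I \<rightarrow> J"
  shows "(\<lambda>s. \<lambda>j\<in>I. s (g j)) \<in> sample J \<rightarrow>\<^sub>M sample I"
  using assms by (intro measurable_restrict measurable_component_singleton) auto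

text \<open>Exchangeability and marginals of a product sample, in one statement.\<close>
lemma integral_sample_reindex:
  fixes f :: "(nat \<Rightarrow> 'b) \<Rightarrow> real"
  assumes "inj_on g I" "g \<in> I \<rightarrow> J" "f \<in> borel_measurable (sample I)"
  shows "(\<integral>s. f (\<lambda>j\<in>I. s (g j)) \<partial>sample J) = (\<integral>s. f s \<partial>sample I)"
proof -
  have "distr (sample J) (sample I) (\<lambda>s. \<lambda>j\<in>I. s (g j)) = sample I"
    using distr_PiM_reindex[of J "\<lambda>_. Q" g I] assms prob_space_axioms by simp
  then have "(\<integral>s. f s \<partial>sample I) = (\<integral>s. f s \<partial>distr (sample J) (sample I) (\<lambda>s. \<lambda>j\<in>I. s (g j)))"
    by simp
  also have "\<dots> = (\<integral>s. f (\<lambda>j\<in>I. s (g j)) \<partial>sample J)"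
    by (rule integral_distr[OF reindex_measurable[OF assms(2)] assms(3)])
  finally show ?thesis by simp
qed

text \<open>The score of observation \<open>k\<close> relative to the observations \<open>e 1, ..., e n\<close>.\<close>
definition score :: "nat \<Rightarrow> (nat \<Rightarrow> nat) \<Rightarrow> (nat \<Rightarrow> 'b) \<Rightarrow> real" where
  "score k e s = c (s k) (\<lambda>j\<in>{1..n}. s (e j))"

lemma score_measurable:
  assumes "k \<in> I" "e \<in> {1..n} \<rightarrow> I"
  shows "score k e \<in> borel_measurable (sample I)"
proof -
  have "(\<lambda>s. (s k, \<lambda>j\<in>{1..n}. s (e j))) \<in> sample I \<rightarrow>\<^sub>M Q \<Otimes>\<^sub>M sample {1..n}"
    using assms by (intro measurable_Pair measurable_component_singleton reindex_measurable)
  from measurable_compose[OF this c_meas] show ?thesis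
    by (simp add: score_def[abs_def])
qed

lemma score_reindex:
  assumes "k \<in> I" "e \<in> {1..n} \<rightarrow> I"
  shows "score k e (\<lambda>j\<in>I. s (g j)) = score (g k) (g \<circ> e) s"
proof -
  have "(\<lambda>j\<in>{1..n}. (\<lambda>j\<in>I. s (g j)) (e j)) = (\<lambda>j\<in>{1..n}. s ((g \<circ> e) j))"
    using assms(2) by (auto intro!: restrict_ext)
  then show ?thesis
    using assms(1) by (simp add: score_def)
qed

lemma score_same_image:
  assumes e: "bij_betw e {1..n} J" "bij_betw e' {1..n} J"
    and s: "s \<in> space (sample I)" and I: "k \<in> I" "J \<subseteq> I"
  shows "score k e s = score k e' s"
proof -
  define \<pi> where "\<pi> j = (if j \<in> {1..n} then inv_into {1..n} e (e' j) else j)" for j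
  have inv: "bij_betw (inv_into {1..n} e) J {1..n}"
    using e(1) by (rule bij_betw_inv_into)
  have "bij_betw (inv_into {1..n} e \<circ> e') {1..n} {1..n}"
    using e(2) inv by (rule bij_betw_trans)
  then have bij: "bij_betw \<pi> {1..n} {1..n}"
    by (rule iffD1[OF bij_betw_cong, rotated]) (simp add: \<pi>_def)
  then have perm: "\<pi> permutes {1..n}"
    by (rule bij_imp_permutes) (auto simp: \<pi>_def)
  define D where "D = (\<lambda>j\<in>{1..n}. s (e j))"
  have sQ: "s j \<in> space Q" if "j \<in> I" for j
    using s that by (auto simp: space_PiM)
  have D: "D \<in> space (sample {1..n})"
    using e(1) I sQ by (auto simp: D_def space_PiM bij_betw_def)
  have "D \<circ> \<pi> = (\<lambda>j\<in>{1..n}. s (e' j))"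
  proof
    fix j show "(D \<circ> \<pi>) j = (\<lambda>j\<in>{1..n}. s (e' j)) j"
    proof (cases "j \<in> {1..n}")
      case True
      then have "\<pi> j \<in> {1..n}" using bij by (auto simp: bij_betw_def)
      moreover have "e (\<pi> j) = e' j"
        using True f_inv_into_f[of "e' j" e "{1..n}"] bij_betw_apply[OF e(2)] e(1)
        by (auto simp: \<pi>_def bij_betw_def)
      ultimately show ?thesis using True by (simp add: D_def)
    next
      case False
      then show ?thesis by (auto simp: \<pi>_def D_def)
    qed
  qed
  then show ?thesis
    using c_sym[OF sQ[OF I(1)] D perm] by (simp add: score_def D_def)
qed

text \<open>The enumeration of the indices other than \<open>i\<close> that is used by \<open>remove_entry\<close>.\<close>
definition skip :: "nat \<Rightarrow> nat \<Rightarrow> nat" where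
  "skip i j = (if j < i then j else j + 1)"

lemma bij_skip: "i \<in> {1..n+1} \<Longrightarrow> bij_betw (skip i) {1..n} ({1..n+1} - {i})"
  by (rule bij_betw_byWitness[where f' = "\<lambda>j. if j < i then j else j - 1"]) (auto simp: skip_def)

text \<open>The score of observation \<open>i\<close> relative to all other observations among the first \<open>n + 1\<close>.\<close>
definition loo_score :: "nat \<Rightarrow> (nat \<Rightarrow> 'b) \<Rightarrow> real" where
  "loo_score i = score i (skip i)"

lemma loo_score_eq: "loo_score i s = c (s i) (remove_entry n i s)"
  by (simp add: loo_score_def score_def remove_entry_def skip_def if_distrib[of s] cong: if_cong)

lemma skip_Pi: "skip i \<in> {1..n} \<rightarrow> {1..n+1}"
  by (auto simp: skip_def)

lemma loo_score_measurable: "i \<in> {1..n+1} \<Longrightarrow> {1..n+1} \<subseteq> I \<Longrightarrow> loo_score i \<in> borel_measurable (sample I)"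
  unfolding loo_score_def using skip_Pi by (intro score_measurable) auto

lemma loo_score_measurable' [measurable]: "i \<in> {1..n+1} \<Longrightarrow> loo_score i \<in> borel_measurable (sample {1..n+1})"
  by (rule loo_score_measurable) auto

lemma loo_score_reindex:
  assumes g: "bij_betw g {1..n+1} {1..n+1}" and I: "{1..n+1} \<subseteq> I"
    and s: "s \<in> space (sample I)" and i: "i \<in> {1..n+1}"
  shows "loo_score i (\<lambda>j\<in>I. s (g j)) = loo_score (g i) s"
proof -
  have gi: "g i \<in> {1..n+1}" using g i by (auto simp: bij_betw_def)
  have "loo_score i (\<lambda>j\<in>I. s (g j)) = score (g i) (g \<circ> skip i) s"
    unfolding loo_score_def using i I skip_Pi[of i] by (intro score_reindex) auto
  also have "\<dots> = loo_score (g i) s"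
    unfolding loo_score_def
  proof (rule score_same_image[OF _ bij_skip[OF gi] s])
    have "bij_betw g ({1..n+1} - {i}) (g ` ({1..n+1} - {i}))"
      using g by (intro inj_on_imp_bij_betw) (auto simp: bij_betw_def inj_on_def)
    also have "g ` ({1..n+1} - {i}) = {1..n+1} - {g i}"
      using g i by (auto simp: bij_betw_def inj_on_def)
    finally show "bij_betw (g \<circ> skip i) {1..n} ({1..n+1} - {g i})"
      by (rule bij_betw_trans[OF bij_skip[OF i]])
  qed (use gi I in auto)
  finally show ?thesis .
qed

text \<open>
  The proportion of the \<open>n + 1\<close> scores that are strictly below the last one. The term \<open>i = n + 1\<close>
  contributes \<open>0\<close>.
\<close>
definition rel_rank :: "(nat \<Rightarrow> 'b) \<Rightarrow> real" where
  "rel_rank s = (\<Sum>i\<in>{1..n+1}. of_bool (loo_score i s < loo_score (n+1) s)) / real (n + 1)"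

lemma rel_rank_bounds: "0 \<le> rel_rank s" "rel_rank s \<le> 1"
proof -
  show "0 \<le> rel_rank s" by (auto simp: rel_rank_def intro!: divide_nonneg_nonneg sum_nonneg)
  have "(\<Sum>i\<in>{1..n+1}. of_bool (loo_score i s < loo_score (n+1) s) :: real) \<le> (\<Sum>i\<in>{1..n+1}. 1)"
    by (intro sum_mono) auto
  then show "rel_rank s \<le> 1" by (simp add: rel_rank_def)
qed

lemma rel_rank_measurable [measurable]: "rel_rank \<in> borel_measurable (sample {1..n+1})"
  unfolding rel_rank_def of_bool_def by measurable

text \<open>
  By exchangeability the last score may be replaced by the average over all \<open>n + 1\<close> scores, to which
  the bound on the squared ranks applies pointwise. Ties only decrease strict ranks.
\<close>
lemma integral_rel_rank_square: "(\<integral>s. (rel_rank s)\<^sup>2 \<partial>sample {1..n+1}) \<le> 1 / 3"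
proof -
  interpret I: prob_space "sample {1..n+1}" by (rule prob_space_sample)
  define r where "r k s = (\<Sum>i\<in>{1..n+1}. of_bool (loo_score i s < loo_score k s) :: real)" for k s
  have r_meas: "(\<lambda>s. (r k s)\<^sup>2) \<in> borel_measurable (sample {1..n+1})" if "k \<in> {1..n+1}" for k
    using that unfolding r_def of_bool_def by measurable
  have r_bound: "\<bar>(r k s)\<^sup>2\<bar> \<le> (real (n + 1))\<^sup>2" for k s
  proof -
    have "r k s \<le> (\<Sum>i\<in>{1..n+1}. 1)" unfolding r_def by (intro sum_mono) auto
    moreover have "0 \<le> r k s" unfolding r_def by (intro sum_nonneg) auto
    ultimately show ?thesis by (simp add: power_mono)
  qed
  have r_int: "integrable (sample {1..n+1}) (\<lambda>s. (r k s)\<^sup>2)" if "k \<in> {1..n+1}" for k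
    by (rule I.integrable_const_bound[where B = "(real (n + 1))\<^sup>2"])
      (use r_bound r_meas[OF that] in auto)
  have r_eq: "(\<integral>s. (r k s)\<^sup>2 \<partial>sample {1..n+1}) = (\<integral>s. (r (n+1) s)\<^sup>2 \<partial>sample {1..n+1})"
    if k: "k \<in> {1..n+1}" for k
  proof -
    define g where "g = Transposition.transpose k (n + 1)"
    have g: "g permutes {1..n+1}"
      unfolding g_def using k by (intro permutes_swap_id) auto
    then have bij: "bij_betw g {1..n+1} {1..n+1}" by (rule permutes_imp_bij)
    have "(\<integral>s. (r (n+1) s)\<^sup>2 \<partial>sample {1..n+1}) =
        (\<integral>s. (r (n+1) (\<lambda>j\<in>{1..n+1}. s (g j)))\<^sup>2 \<partial>sample {1..n+1})"
      using bij by (intro integral_sample_reindex[symmetric] r_meas) (auto simp: bij_betw_def)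
    also have "\<dots> = (\<integral>s. (r k s)\<^sup>2 \<partial>sample {1..n+1})"
    proof (intro Bochner_Integration.integral_cong refl)
      fix s assume s: "s \<in> space (sample {1..n+1})"
      have "r (n+1) (\<lambda>j\<in>{1..n+1}. s (g j)) = (\<Sum>i\<in>{1..n+1}. of_bool (loo_score (g i) s < loo_score (g (n+1)) s))"
        unfolding r_def using loo_score_reindex[OF bij order_refl s] by (intro sum.cong) auto
      also have "\<dots> = r (g (n+1)) s"
        unfolding r_def by (rule sum.reindex_bij_betw[OF bij])
      also have "g (n+1) = k" by (simp add: g_def)
      finally show "(r (n+1) (\<lambda>j\<in>{1..n+1}. s (g j)))\<^sup>2 = (r k s)\<^sup>2" by (rule arg_cong)
    qed
    finally show ?thesis by simp
  qed
  have "real (n+1) * (\<integral>s. (r (n+1) s)\<^sup>2 \<partial>sample {1..n+1}) =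
      (\<Sum>k\<in>{1..n+1}. \<integral>s. (r k s)\<^sup>2 \<partial>sample {1..n+1})"
  proof -
    have "(\<Sum>k\<in>{1..n+1}. \<integral>s. (r k s)\<^sup>2 \<partial>sample {1..n+1}) =
        (\<Sum>k\<in>{1..n+1}. \<integral>s. (r (n+1) s)\<^sup>2 \<partial>sample {1..n+1})"
      by (rule sum.cong[OF refl r_eq])
    then show ?thesis by (simp only: sum_constant card_atLeastAtMost diff_Suc_1 Suc_eq_plus1 add_diff_cancel_right')
  qed
  also have "\<dots> = (\<integral>s. (\<Sum>k\<in>{1..n+1}. (r k s)\<^sup>2) \<partial>sample {1..n+1})"
    using r_int by (intro Bochner_Integration.integral_sum[symmetric])
  also have "\<dots> \<le> (\<integral>s. real (n+1) ^ 3 / 3 \<partial>sample {1..n+1})"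
  proof (rule integral_mono)
    fix s
    show "(\<Sum>k\<in>{1..n+1}. (r k s)\<^sup>2) \<le> real (n+1) ^ 3 / 3"
      using sum_strict_rank_square_le[of "{1..n+1}" "\<lambda>i. loo_score i s"] by (simp add: r_def)
  qed (rule Bochner_Integration.integrable_sum[OF r_int] integrable_sample_const, assumption?)+
  also have "\<dots> = real (n+1) ^ 3 / 3" by simp
  finally have *: "real (n+1) * (\<integral>s. (r (n+1) s)\<^sup>2 \<partial>sample {1..n+1}) \<le> real (n+1) ^ 3 / 3" .
  have "(\<integral>s. (rel_rank s)\<^sup>2 \<partial>sample {1..n+1}) = (\<integral>s. (r (n+1) s)\<^sup>2 \<partial>sample {1..n+1}) / (real (n+1))\<^sup>2"
    by (simp add: rel_rank_def r_def power_divide)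
  also have "\<dots> \<le> 1 / 3"
  proof -
    have "real (n+1) * (\<integral>s. (r (n+1) s)\<^sup>2 \<partial>sample {1..n+1}) \<le> real (n+1) * ((real (n+1))\<^sup>2 / 3)"
      using * by (simp only: power2_eq_square power3_eq_cube times_divide_eq_right mult.assoc)
    then have "(\<integral>s. (r (n+1) s)\<^sup>2 \<partial>sample {1..n+1}) \<le> (real (n+1))\<^sup>2 / 3"
      by (rule mult_left_le_imp_le) simp
    then show ?thesis by (subst pos_divide_le_eq) auto
  qed
  finally show ?thesis .
qed

section \<open>Three observations on top of a common sample of size \<open>n - 1\<close>\<close>
lemma integrable_bounded:
  fixes f :: "(nat \<Rightarrow> 'b) \<Rightarrow> real"
  assumes "f \<in> borel_measurable (sample I)" "\<And>s. \<bar>f s\<bar> \<le> B"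
  shows "integrable (sample I) f"
proof -
  interpret I: prob_space "sample I" by (rule prob_space_sample)
  show ?thesis
    by (rule I.integrable_const_bound[where B = B]) (use assms in auto)
qed

lemma integral_sample_insert:
  fixes f :: "(nat \<Rightarrow> 'b) \<Rightarrow> real"
  assumes "f \<in> borel_measurable (sample {1..m+1})" "\<And>s. \<bar>f s\<bar> \<le> B"
  shows "(\<integral>s. f s \<partial>sample {1..m+1}) = (\<integral>T. (\<integral>z. f (T(m+1 := z)) \<partial>Q) \<partial>sample {1..m})"
proof -
  interpret PS: product_sigma_finite "\<lambda>_. Q" by unfold_locales
  have eq: "{1..m+1} = insert (m+1) {1..m}" by auto
  have "integrable (sample (insert (m+1) {1..m})) f"
    using integrable_bounded[OF assms] unfolding eq .
  from PS.product_integral_insert[OF _ _ this] show ?thesis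
    unfolding eq by simp
qed

text \<open>
  The score of observation \<open>x\<close> relative to observations \<open>1, ..., n - 1\<close> and \<open>y\<close>. The indices
  \<open>x \<noteq> y\<close> will be among \<open>n\<close>, \<open>n + 1\<close>, \<open>n + 2\<close>.
\<close>
definition pair_score :: "nat \<Rightarrow> nat \<Rightarrow> (nat \<Rightarrow> 'b) \<Rightarrow> real" where
  "pair_score x y = score x (id(n := y))"

text \<open>The score of observation \<open>x\<close> relative to observations \<open>1, ..., n - 1\<close>.\<close>
definition base_score :: "nat \<Rightarrow> (nat \<Rightarrow> 'b) \<Rightarrow> real" where
  "base_score x s = c' (s x) (restrict s {1..n-1})"

lemma pair_score_measurable:
  assumes "{1..n-1} \<subseteq> I" "x \<in> I" "y \<in> I"
  shows "pair_score x y \<in> borel_measurable (sample I)"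
proof -
  have "id(n := y) \<in> {1..n} \<rightarrow> I"
    using assms by (auto simp: subset_eq)
  then show ?thesis unfolding pair_score_def using assms by (intro score_measurable)
qed

lemma base_score_measurable:
  assumes "{1..n-1} \<subseteq> I" "x \<in> I"
  shows "base_score x \<in> borel_measurable (sample I)"
proof -
  have "(\<lambda>s. (s x, restrict s {1..n-1})) \<in> sample I \<rightarrow>\<^sub>M Q \<Otimes>\<^sub>M sample {1..n-1}"
    using assms by (intro measurable_Pair measurable_component_singleton measurable_restrict_subset)
  from measurable_compose[OF this c'_meas] show ?thesis
    by (simp add: base_score_def[abs_def])
qed

lemma pair_score_reindex:
  assumes "{1..n-1} \<subseteq> I" "x \<in> I" "y \<in> I" "\<And>j. j \<in> {1..n-1} \<Longrightarrow> g j = j"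
  shows "pair_score x y (\<lambda>j\<in>I. s (g j)) = pair_score (g x) (g y) s"
proof -
  have "id(n := y) \<in> {1..n} \<rightarrow> I"
    using assms by (auto simp: subset_eq)
  then have "pair_score x y (\<lambda>j\<in>I. s (g j)) = score (g x) (g \<circ> id(n := y)) s"
    unfolding pair_score_def using assms(2) by (intro score_reindex)
  also have "\<dots> = pair_score (g x) (g y) s"
    unfolding pair_score_def score_def using assms(4) by (intro arg_cong2[where f = c] refl restrict_ext) auto
  finally show ?thesis .
qed

lemma base_score_reindex:
  assumes "{1..n-1} \<subseteq> I" "x \<in> I" "\<And>j. j \<in> {1..n-1} \<Longrightarrow> g j = j"
  shows "base_score x (\<lambda>j\<in>I. s (g j)) = base_score (g x) s"
proof -
  have "restrict (\<lambda>j\<in>I. s (g j)) {1..n-1} = restrict s {1..n-1}"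
    using assms by (intro ext) (auto simp: restrict_def)
  then show ?thesis using assms(2) by (simp add: base_score_def)
qed

lemma loo_score_last_pair: "loo_score (n+1) s = pair_score (n+1) n s"
  by (auto simp: loo_score_def pair_score_def score_def skip_def intro!: arg_cong2[where f = c] restrict_ext)

lemma loo_score_last: "loo_score (n+1) s = c (s (n+1)) (restrict s {1..n})"
  by (auto simp: loo_score_def score_def skip_def intro!: arg_cong2[where f = c] restrict_ext)

lemma loo_score_n: "loo_score n s = pair_score n (n+1) s"
  using n_pos by (auto simp: loo_score_def pair_score_def score_def skip_def intro!: arg_cong2[where f = c] restrict_ext)

text \<open>The probability that removing one observation changes the score by more than \<open>\<eta>\<close>.\<close>
definition instability :: "real \<Rightarrow> real" where
  "instability \<eta> = (\<integral>s. of_bool (\<bar>pair_score (n+1) n s - base_score (n+1) s\<bar> > \<eta>) \<partial>sample {1..n+1})"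

text \<open>
  The probability that two observations have scores within \<open>\<eta>\<close> of each other, both relative to the
  same \<open>n\<close> observations.
\<close>
definition near_tie :: "real \<Rightarrow> real" where
  "near_tie \<eta> = (\<integral>s. of_bool (\<bar>pair_score (n+1) n s - pair_score (n+2) n s\<bar> \<le> \<eta>) \<partial>sample {1..n+2})"

text \<open>
  Observation \<open>y\<close> beats \<open>x\<close>, each being scored relative to a sample that contains the other, and
  \<open>y\<close> beats \<open>w\<close>, both being scored relative to a sample that contains \<open>x\<close>.
\<close>
definition above_both :: "nat \<Rightarrow> nat \<Rightarrow> nat \<Rightarrow> (nat \<Rightarrow> 'b) \<Rightarrow> bool" where
  "above_both x y w s \<longleftrightarrow> pair_score x y s < pair_score y x s \<and> pair_score w x s < pair_score y x s"

text \<open>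
  The probability of this event for the indices \<open>n\<close>, \<open>n + 1\<close>, \<open>n + 2\<close>; by exchangeability it is the same
  for every permutation of them (\<open>prob_above_eq\<close>).
\<close>
definition prob_above :: real where
  "prob_above = (\<integral>s. of_bool (above_both n (n+1) (n+2) s) \<partial>sample {1..n+2})"

lemma of_bool_measurable [measurable (raw)]:
  "Measurable.pred M P \<Longrightarrow> (\<lambda>x. of_bool (P x) :: real) \<in> borel_measurable M"
  unfolding of_bool_def by measurable

lemma instability_eq:
  assumes "x \<in> {n, n+1, n+2}" "y \<in> {n, n+1, n+2}" "x \<noteq> y"
  shows "(\<integral>s. of_bool (\<bar>pair_score x y s - base_score x s\<bar> > \<eta>) \<partial>sample {1..n+2}) = instability \<eta>"
proof -
  define g where "g = id(n := y, n+1 := x)"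
  have inj: "inj_on g {1..n+1}"
    using assms n_pos  by (auto simp: g_def inj_on_def)
  have im: "g \<in> {1..n+1} \<rightarrow> {1..n+2}"
    using assms n_pos  by (auto simp: g_def split: if_split_asm)
  have gid: "\<And>j. j \<in> {1..n-1} \<Longrightarrow> g j = j" by (auto simp: g_def)
  have sub: "{1..n-1} \<subseteq> {1..n+1}" by auto
  have [measurable]: "pair_score (n+1) n \<in> borel_measurable (sample {1..n+1})"
      "base_score (n+1) \<in> borel_measurable (sample {1..n+1})"
    using n_pos by (auto intro!: pair_score_measurable base_score_measurable)
  have "(\<integral>s. of_bool (\<bar>pair_score x y s - base_score x s\<bar> > \<eta>) \<partial>sample {1..n+2}) =
      (\<integral>s. of_bool (\<bar>pair_score (n+1) n (\<lambda>j\<in>{1..n+1}. s (g j)) - base_score (n+1) (\<lambda>j\<in>{1..n+1}. s (g j))\<bar> > \<eta>)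
         \<partial>sample {1..n+2})"
    using pair_score_reindex[OF sub _ _ gid, of "n+1" n] base_score_reindex[OF sub _ gid, of "n+1"] n_pos
    by (simp add: g_def)
  also have "\<dots> = instability \<eta>"
    unfolding instability_def by (rule integral_sample_reindex[OF inj im]) measurable
  finally show ?thesis .
qed

lemma near_tie_eq:
  assumes "{x, y, w} = {n, n+1, n+2}" "x \<noteq> y" "x \<noteq> w" "y \<noteq> w"
  shows "(\<integral>s. of_bool (\<bar>pair_score x w s - pair_score y w s\<bar> \<le> \<eta>) \<partial>sample {1..n+2}) = near_tie \<eta>"
proof -
  define g where "g = id(n := w, n+1 := x, n+2 := y)"
  have xyw: "x \<in> {n,n+1,n+2}" "y \<in> {n,n+1,n+2}" "w \<in> {n,n+1,n+2}" using assms(1) by blast+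
  have inj: "inj_on g {1..n+2}"
    using xyw assms(2-4) n_pos  by (auto simp: g_def inj_on_def)
  have im: "g \<in> {1..n+2} \<rightarrow> {1..n+2}"
    using xyw assms(2-4) n_pos  by (auto simp: g_def split: if_split_asm)
  have gid: "\<And>j. j \<in> {1..n-1} \<Longrightarrow> g j = j" by (auto simp: g_def)
  have sub: "{1..n-1} \<subseteq> {1..n+2}" by auto
  have [measurable]: "pair_score (n+1) n \<in> borel_measurable (sample {1..n+2})"
      "pair_score (n+2) n \<in> borel_measurable (sample {1..n+2})"
    using n_pos by (auto intro!: pair_score_measurable)
  have "(\<integral>s. of_bool (\<bar>pair_score x w s - pair_score y w s\<bar> \<le> \<eta>) \<partial>sample {1..n+2}) =
      (\<integral>s. of_bool (\<bar>pair_score (n+1) n (\<lambda>j\<in>{1..n+2}. s (g j)) - pair_score (n+2) n (\<lambda>j\<in>{1..n+2}. s (g j))\<bar> \<le> \<eta>)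
         \<partial>sample {1..n+2})"
    using pair_score_reindex[OF sub _ _ gid, of "n+1" n] pair_score_reindex[OF sub _ _ gid, of "n+2" n] n_pos
    by (simp add: g_def)
  also have "\<dots> = near_tie \<eta>"
    unfolding near_tie_def by (rule integral_sample_reindex[OF inj im]) measurable
  finally show ?thesis .
qed

lemma pair_score_measurable3:
  "x \<in> {n,n+1,n+2} \<Longrightarrow> y \<in> {n,n+1,n+2} \<Longrightarrow> pair_score x y \<in> borel_measurable (sample {1..n+2})"
  "x \<in> {n,n+1,n+2} \<Longrightarrow> base_score x \<in> borel_measurable (sample {1..n+2})"
  using n_pos by (auto intro!: pair_score_measurable base_score_measurable)

lemma above_both_measurable:
  assumes "{x, y, w} \<subseteq> {n, n+1, n+2}"
  shows "Measurable.pred (sample {1..n+2}) (above_both x y w)"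
proof -
  have xyw: "x \<in> {n,n+1,n+2}" "y \<in> {n,n+1,n+2}" "w \<in> {n,n+1,n+2}" using assms by blast+
  note [measurable] = pair_score_measurable3(1)[OF xyw(1,2)] pair_score_measurable3(1)[OF xyw(2,1)] pair_score_measurable3(1)[OF xyw(3,1)]
  show ?thesis unfolding above_both_def by measurable
qed

lemma prob_above_eq:
  assumes "{x, y, w} = {n, n+1, n+2}" "x \<noteq> y" "x \<noteq> w" "y \<noteq> w"
  shows "(\<integral>s. of_bool (above_both x y w s) \<partial>sample {1..n+2}) = prob_above"
proof -
  define g where "g = id(n := x, n+1 := y, n+2 := w)"
  have xyw: "x \<in> {n,n+1,n+2}" "y \<in> {n,n+1,n+2}" "w \<in> {n,n+1,n+2}" using assms(1) by blast+
  have inj: "inj_on g {1..n+2}"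
    using xyw assms(2-4) n_pos  by (auto simp: g_def inj_on_def)
  have im: "g \<in> {1..n+2} \<rightarrow> {1..n+2}"
    using xyw assms(2-4) n_pos  by (auto simp: g_def split: if_split_asm)
  have gid: "\<And>j. j \<in> {1..n-1} \<Longrightarrow> g j = j" by (auto simp: g_def)
  have sub: "{1..n-1} \<subseteq> {1..n+2}" by auto
  have [measurable]: "Measurable.pred (sample {1..n+2}) (above_both n (n+1) (n+2))"
    by (rule above_both_measurable) auto
  have "(\<integral>s. of_bool (above_both x y w s) \<partial>sample {1..n+2}) =
      (\<integral>s. of_bool (above_both n (n+1) (n+2) (\<lambda>j\<in>{1..n+2}. s (g j))) \<partial>sample {1..n+2})"
    using pair_score_reindex[OF sub _ _ gid, of "n+1" n] pair_score_reindex[OF sub _ _ gid, of "n+2" n]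
      pair_score_reindex[OF sub _ _ gid, of n "n+1"] n_pos
    by (simp add: g_def above_both_def)
  also have "\<dots> = prob_above"
    unfolding prob_above_def by (rule integral_sample_reindex[OF inj im]) measurable
  finally show ?thesis .
qed

text \<open>
  The three cyclic versions of the event \<open>above_both\<close> cover everything except three near ties and six
  instabilities.
\<close>
lemma prob_above_ge: "prob_above \<ge> 1 / 3 - near_tie (2 * \<delta>) - 2 * instability (\<delta> / 2)"
proof -
  let ?I = "\<lambda>f. \<integral>s. f s \<partial>sample {1..n+2}"
  let ?A = "\<lambda>x y w s. of_bool (above_both x y w s) :: real"
  let ?T = "\<lambda>x y w s. of_bool (\<bar>pair_score x w s - pair_score y w s\<bar> \<le> 2 * \<delta>) :: real"
  let ?D = "\<lambda>x y s. of_bool (\<bar>pair_score x y s - base_score x s\<bar> > \<delta> / 2) :: real"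
  let ?i = "n" and ?k = "n+1" and ?l = "n+2"
  have intA: "integrable (sample {1..n+2}) (?A x y w)" if "{x, y, w} \<subseteq> {?i, ?k, ?l}" for x y w
    using above_both_measurable[OF that]
    by (intro integrable_bounded[where B = 1]) auto
  have intT: "integrable (sample {1..n+2}) (?T x y w)"
    if "x \<in> {?i, ?k, ?l}" "y \<in> {?i, ?k, ?l}" "w \<in> {?i, ?k, ?l}" for x y w
  proof (rule integrable_bounded[where B = 1])
    have [measurable]: "pair_score x w \<in> borel_measurable (sample {1..n+2})"
        "pair_score y w \<in> borel_measurable (sample {1..n+2})"
      using that by (intro pair_score_measurable3; blast)+
    show "?T x y w \<in> borel_measurable (sample {1..n+2})" by measurable
  qed simp
  have intD: "integrable (sample {1..n+2}) (?D x y)"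
    if "x \<in> {?i, ?k, ?l}" "y \<in> {?i, ?k, ?l}" for x y
  proof (rule integrable_bounded[where B = 1])
    have [measurable]: "pair_score x y \<in> borel_measurable (sample {1..n+2})"
        "base_score x \<in> borel_measurable (sample {1..n+2})"
      using that by (intro pair_score_measurable3; blast)+
    show "?D x y \<in> borel_measurable (sample {1..n+2})" by measurable
  qed simp
  \<comment> \<open>\<open>R\<close> counts those of the twelve events that occur; at least one of them always does.\<close>
  define R where "R s = (?A ?i ?k ?l s + ?A ?k ?l ?i s + ?A ?l ?i ?k s)
      + (?T ?i ?k ?l s + ?T ?i ?l ?k s + ?T ?k ?l ?i s)
      + (?D ?i ?k s + ?D ?i ?l s + ?D ?k ?i s + ?D ?k ?l s + ?D ?l ?i s + ?D ?l ?k s)" for s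
  have "?I (\<lambda>s. 1) \<le> ?I R"
  proof (rule integral_mono)
    show "integrable (sample {1..n+2}) (\<lambda>s. 1::real)" by simp
    show "integrable (sample {1..n+2}) R" unfolding R_def
      by (intro Bochner_Integration.integrable_add intA intT intD) auto
    fix s
    show "1 \<le> R s"
    proof (rule ccontr)
      assume "\<not> 1 \<le> R s"
      then have less: "R s < 1" by simp
      have not_if: "\<not> P" if "of_bool P < (1 :: real)" for P
        using that by (cases P) auto
      have nn: "0 \<le> ?A ?i ?k ?l s" "0 \<le> ?A ?k ?l ?i s" "0 \<le> ?A ?l ?i ?k s"
        "0 \<le> ?T ?i ?k ?l s" "0 \<le> ?T ?i ?l ?k s" "0 \<le> ?T ?k ?l ?i s"
        "0 \<le> ?D ?i ?k s" "0 \<le> ?D ?i ?l s" "0 \<le> ?D ?k ?i s"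
        "0 \<le> ?D ?k ?l s" "0 \<le> ?D ?l ?i s" "0 \<le> ?D ?l ?k s"
        by (rule zero_less_eq_of_bool)+
      have "\<not> above_both ?i ?k ?l s" "\<not> above_both ?k ?l ?i s" "\<not> above_both ?l ?i ?k s"
        "\<not> \<bar>pair_score ?i ?l s - pair_score ?k ?l s\<bar> \<le> 2 * \<delta>" "\<not> \<bar>pair_score ?i ?k s - pair_score ?l ?k s\<bar> \<le> 2 * \<delta>"
        "\<not> \<bar>pair_score ?k ?i s - pair_score ?l ?i s\<bar> \<le> 2 * \<delta>"
        "\<not> \<bar>pair_score ?i ?k s - base_score ?i s\<bar> > \<delta> / 2" "\<not> \<bar>pair_score ?i ?l s - base_score ?i s\<bar> > \<delta> / 2"
        "\<not> \<bar>pair_score ?k ?i s - base_score ?k s\<bar> > \<delta> / 2" "\<not> \<bar>pair_score ?k ?l s - base_score ?k s\<bar> > \<delta> / 2"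
        "\<not> \<bar>pair_score ?l ?i s - base_score ?l s\<bar> > \<delta> / 2" "\<not> \<bar>pair_score ?l ?k s - base_score ?l s\<bar> > \<delta> / 2"
        by (rule not_if, use less[unfolded R_def] nn in linarith)+
      then show False unfolding above_both_def
        using separated_scores_have_maximum[of "pair_score ?i ?k s" "base_score ?i s" \<delta> "pair_score ?i ?l s" "pair_score ?k ?i s"
              "base_score ?k s" "pair_score ?k ?l s" "pair_score ?l ?i s" "base_score ?l s" "pair_score ?l ?k s"]
        unfolding not_le not_less by blast
    qed
  qed
  also have "\<dots> = (?I (?A ?i ?k ?l) + ?I (?A ?k ?l ?i) + ?I (?A ?l ?i ?k))
      + (?I (?T ?i ?k ?l) + ?I (?T ?i ?l ?k) + ?I (?T ?k ?l ?i))
      + (?I (?D ?i ?k) + ?I (?D ?i ?l) + ?I (?D ?k ?i) + ?I (?D ?k ?l) + ?I (?D ?l ?i) + ?I (?D ?l ?k))"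
  proof -
    have iA: "integrable (sample {1..n+2}) (?A ?i ?k ?l)" "integrable (sample {1..n+2}) (?A ?k ?l ?i)"
      "integrable (sample {1..n+2}) (?A ?l ?i ?k)"
      by (rule intA; simp)+
    have iT: "integrable (sample {1..n+2}) (?T ?i ?k ?l)" "integrable (sample {1..n+2}) (?T ?i ?l ?k)"
      "integrable (sample {1..n+2}) (?T ?k ?l ?i)"
      by (rule intT; simp)+
    have iD: "integrable (sample {1..n+2}) (?D ?i ?k)" "integrable (sample {1..n+2}) (?D ?i ?l)"
      "integrable (sample {1..n+2}) (?D ?k ?i)" "integrable (sample {1..n+2}) (?D ?k ?l)"
      "integrable (sample {1..n+2}) (?D ?l ?i)" "integrable (sample {1..n+2}) (?D ?l ?k)"
      by (rule intD; simp)+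
    show ?thesis
      unfolding R_def
      by (simp only: Bochner_Integration.integral_add Bochner_Integration.integrable_add iA iT iD)
  qed
  also have "\<dots> = 3 * prob_above + 3 * near_tie (2 * \<delta>) + 6 * instability (\<delta> / 2)"
  proof -
    have "?I (?A ?i ?k ?l) = prob_above" "?I (?A ?k ?l ?i) = prob_above" "?I (?A ?l ?i ?k) = prob_above"
      by (rule prob_above_eq; auto)+
    moreover have "?I (?T ?i ?k ?l) = near_tie (2 * \<delta>)" "?I (?T ?i ?l ?k) = near_tie (2 * \<delta>)"
        "?I (?T ?k ?l ?i) = near_tie (2 * \<delta>)"
      by (rule near_tie_eq; auto)+
    moreover have "?I (?D x y) = instability (\<delta> / 2)"
      if "x \<in> {?i, ?k, ?l}" "y \<in> {?i, ?k, ?l}" "x \<noteq> y" for x y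
      using that by (rule instability_eq)
    ultimately show ?thesis by simp
  qed
  finally show ?thesis by simp
qed

section \<open>Relative rank and probability integral transform\<close>
lemma integral_of_bool_eq: "(\<integral>z. of_bool (P z) \<partial>Q) = measure Q {z \<in> space Q. P z}"
proof -
  have "(\<integral>z. of_bool (P z) \<partial>Q) = (\<integral>z. indicator {z \<in> space Q. P z} z \<partial>Q)"
    by (intro Bochner_Integration.integral_cong) (auto simp: indicator_def)
  also have "\<dots> = measure Q {z \<in> space Q. P z}"
    by (auto intro!: arg_cong[where f = "measure Q"])
  finally show ?thesis .
qed

text \<open>
  The conditional distribution function of a new score given the \<open>n\<close>-tuple \<open>T\<close>, in its left-continuous
  version, so that it corresponds to the strict inequality in \<open>rel_rank\<close>.
\<close>
definition cond_cdf :: "(nat \<Rightarrow> 'b) \<Rightarrow> real \<Rightarrow> real" where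
  "cond_cdf T x = measure Q {z \<in> space Q. c z T < x}"

lemma c_measurable:
  assumes "T \<in> space (sample {1..n})"
  shows "(\<lambda>z. c z T) \<in> borel_measurable Q"
proof -
  have "(\<lambda>z. (z, T)) \<in> Q \<rightarrow>\<^sub>M Q \<Otimes>\<^sub>M sample {1..n}"
    using assms by simp
  from measurable_compose[OF this c_meas] show ?thesis by simp
qed

lemma cond_cdf_bounds: "0 \<le> cond_cdf T x" "cond_cdf T x \<le> 1"
  by (auto simp: cond_cdf_def)

lemma cond_cdf_eq_integral: "cond_cdf T x = (\<integral>z. of_bool (c z T < x) \<partial>Q)"
  by (simp add: cond_cdf_def integral_of_bool_eq)

text \<open>The conditional distribution function given the first \<open>n\<close> observations, at the last score.\<close>
definition pit :: "(nat \<Rightarrow> 'b) \<Rightarrow> real" where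
  "pit s = cond_cdf (restrict s {1..n}) (loo_score (n+1) s)"

lemma pit_bounds: "0 \<le> pit s" "pit s \<le> 1"
  by (auto simp: pit_def cond_cdf_bounds)

lemma pit_measurable [measurable]: "pit \<in> borel_measurable (sample {1..n+1})"
proof -
  have loo_score: "loo_score (n+1) \<in> borel_measurable (sample {1..n+1})" by (rule loo_score_measurable') auto
  have "(\<lambda>(s, z). (z, restrict s {1..n})) \<in> sample {1..n+1} \<Otimes>\<^sub>M Q \<rightarrow>\<^sub>M Q \<Otimes>\<^sub>M sample {1..n}"
    unfolding case_prod_beta
    by (intro measurable_Pair measurable_snd measurable_compose[OF measurable_fst] measurable_restrict_subset) auto
  from measurable_compose[OF this c_meas]
  have [measurable]: "(\<lambda>(s, z). c z (restrict s {1..n})) \<in> borel_measurable (sample {1..n+1} \<Otimes>\<^sub>M Q)"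
    by (simp add: case_prod_beta)
  have [measurable]: "(\<lambda>(s, z). loo_score (n+1) s) \<in> borel_measurable (sample {1..n+1} \<Otimes>\<^sub>M Q)"
    unfolding case_prod_beta by (rule measurable_compose[OF measurable_fst loo_score])
  have "(\<lambda>(s, z). of_bool (c z (restrict s {1..n}) < loo_score (n+1) s) :: real) \<in>
      borel_measurable (sample {1..n+1} \<Otimes>\<^sub>M Q)"
    unfolding case_prod_beta of_bool_def by measurable
  from borel_measurable_lebesgue_integral[OF this] show ?thesis
    by (simp add: pit_def[abs_def] cond_cdf_eq_integral)
qed

text \<open>
  The factor \<open>pit\<close> is a conditional probability for the score of an independent further observation
  \<open>n + 2\<close>. Each of the \<open>n\<close> non-zero terms of the rank therefore contributes the same probability.
\<close>
lemma integral_rel_rank_mult_pit: "(\<integral>s. rel_rank s * pit s \<partial>sample {1..n+1}) = real n / real (n + 1) * prob_above"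
proof -
  define h where "h i s = (of_bool (score i (skip i) s < pair_score (n+1) n s \<and> pair_score (n+2) n s < pair_score (n+1) n s) :: real)" for i s
  have Sm: "pair_score (n+1) n \<in> borel_measurable (sample {1..n+2})" "pair_score (n+2) n \<in> borel_measurable (sample {1..n+2})"
    using n_pos by (auto intro!: pair_score_measurable)
  have sm: "loo_score i \<in> borel_measurable (sample {1..n+2})" if "i \<in> {1..n+1}" for i
    using that by (intro loo_score_measurable) auto
  have h_meas: "h i \<in> borel_measurable (sample {1..n+2})" if "i \<in> {1..n+1}" for i
  proof -
    note [measurable] = Sm sm[OF that]
    show ?thesis unfolding h_def loo_score_def[symmetric] of_bool_def by measurable
  qed
  have step: "(\<integral>s. of_bool (loo_score i s < loo_score (n+1) s) * pit s \<partial>sample {1..n+1}) =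
      (\<integral>s. h i s \<partial>sample {1..n+2})" if i: "i \<in> {1..n+1}" for i
  proof -
    have "(\<integral>s. h i s \<partial>sample {1..n+2}) =
        (\<integral>s. (\<integral>z. h i (s(n+2 := z)) \<partial>Q) \<partial>sample {1..n+1})"
      using integral_sample_insert[of "h i" "n+1" 1] h_meas[OF i] by (simp add: h_def)
    also have "\<dots> = (\<integral>s. of_bool (loo_score i s < loo_score (n+1) s) * pit s \<partial>sample {1..n+1})"
    proof (rule Bochner_Integration.integral_cong[OF refl])
      fix s
      have 1: "score i (skip i) (s(n+2 := z)) = loo_score i s" for z
        using i unfolding loo_score_def score_def
        by (intro arg_cong2[where f = c] restrict_ext) (auto simp: skip_def)
      have 2: "pair_score (n+1) n (s(n+2 := z)) = loo_score (n+1) s" for z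
        unfolding loo_score_last_pair pair_score_def score_def
        by (intro arg_cong2[where f = c] restrict_ext) auto
      have 3: "pair_score (n+2) n (s(n+2 := z)) = c z (restrict s {1..n})" for z
        unfolding pair_score_def score_def
        by (intro arg_cong2[where f = c] restrict_ext) auto
      show "(\<integral>z. h i (s(n+2 := z)) \<partial>Q) = of_bool (loo_score i s < loo_score (n+1) s) * pit s"
        unfolding h_def 1 2 3 pit_def cond_cdf_eq_integral by (simp add: of_bool_conj)
    qed
    finally show ?thesis by simp
  qed
  \<comment> \<open>The transposition of \<open>i\<close> and \<open>n\<close> takes the score of \<open>n\<close> to that of \<open>i\<close> and, by symmetry of
    \<open>c\<close>, leaves the other two scores unchanged.\<close>
  have h_eq: "(\<integral>s. h i s \<partial>sample {1..n+2}) = prob_above" if i: "i \<in> {1..n}" for i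
  proof -
    define g where "g = Transposition.transpose i n"
    have "g permutes {1..n+2}"
      unfolding g_def using i by (intro permutes_swap_id) auto
    then have bij: "bij_betw g {1..n+2} {1..n+2}" by (rule permutes_imp_bij)
    have "g permutes {1..n+1}"
      unfolding g_def using i by (intro permutes_swap_id) auto
    then have bij1: "bij_betw g {1..n+1} {1..n+1}" by (rule permutes_imp_bij)
    have "g permutes {1..n}"
      unfolding g_def using i by (intro permutes_swap_id) auto
    then have bij2: "bij_betw g {1..n} {1..n}" by (rule permutes_imp_bij)
    have gv: "g n = i" "g (n+1) = n+1" "g (n+2) = n+2"
      using i by (auto simp: g_def Transposition.transpose_def)
    have "prob_above = (\<integral>s. of_bool (above_both n (n+1) (n+2) (\<lambda>j\<in>{1..n+2}. s (g j))) \<partial>sample {1..n+2})"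
    proof -
      have "Measurable.pred (sample {1..n+2}) (above_both n (n+1) (n+2))"
        by (rule above_both_measurable) auto
      then show ?thesis unfolding prob_above_def
        using bij by (intro integral_sample_reindex[symmetric] of_bool_measurable) (auto simp: bij_betw_def)
    qed
    also have "\<dots> = (\<integral>s. h i s \<partial>sample {1..n+2})"
    proof (rule Bochner_Integration.integral_cong[OF refl])
      fix s assume s: "s \<in> space (sample {1..n+2})"
      let ?s = "\<lambda>j\<in>{1..n+2}. s (g j)"
      have "loo_score n ?s = loo_score i s" "loo_score (n+1) ?s = loo_score (n+1) s"
        using loo_score_reindex[OF bij1 _ s, of n] loo_score_reindex[OF bij1 _ s, of "n+1"] n_pos gv by auto
      moreover have "pair_score (n+2) n ?s = pair_score (n+2) n s"
      proof -
        have "pair_score (n+2) n ?s = score (g (n+2)) (g \<circ> id(n := n)) s"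
          unfolding pair_score_def by (intro score_reindex) auto
        also have "\<dots> = pair_score (n+2) n s"
          unfolding pair_score_def gv
          by (rule score_same_image[OF _ _ s, of _ "{1..n}"]) (use bij2 in \<open>simp_all add: bij_betw_id_iff fun_upd_idem[of id] del: One_nat_def\<close>)
        finally show ?thesis .
      qed
      ultimately show "of_bool (above_both n (n+1) (n+2) ?s) = h i s"
        by (simp only: above_both_def h_def loo_score_n[symmetric] loo_score_last_pair[symmetric] loo_score_def[of i, symmetric])
    qed
    finally show ?thesis by simp
  qed
  have int: "integrable (sample {1..n+1}) (\<lambda>s. of_bool (loo_score i s < loo_score (n+1) s) * pit s)"
    if "i \<in> {1..n+1}" for i
  proof (rule integrable_bounded[where B = 1])
    have [measurable]: "loo_score i \<in> borel_measurable (sample {1..n+1})" "loo_score (n+1) \<in> borel_measurable (sample {1..n+1})"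
      using that by - (rule loo_score_measurable', simp)+
    show "(\<lambda>s. of_bool (loo_score i s < loo_score (n+1) s) * pit s) \<in> borel_measurable (sample {1..n+1})"
      by measurable
  qed (auto simp: pit_bounds)
  have "(\<integral>s. rel_rank s * pit s \<partial>sample {1..n+1}) =
      (\<integral>s. (\<Sum>i\<in>{1..n+1}. of_bool (loo_score i s < loo_score (n+1) s) * pit s) / real (n+1) \<partial>sample {1..n+1})"
    unfolding rel_rank_def by (simp only: sum_distrib_right times_divide_eq_left)
  also have "\<dots> = (\<Sum>i\<in>{1..n+1}. \<integral>s. of_bool (loo_score i s < loo_score (n+1) s) * pit s \<partial>sample {1..n+1}) / real (n+1)"
    by (simp only: integral_divide_zero Bochner_Integration.integral_sum[OF int])
  also have "(\<Sum>i\<in>{1..n+1}. \<integral>s. of_bool (loo_score i s < loo_score (n+1) s) * pit s \<partial>sample {1..n+1}) =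
      (\<Sum>i\<in>{1..n}. \<integral>s. of_bool (loo_score i s < loo_score (n+1) s) * pit s \<partial>sample {1..n+1})"
    by simp
  also have "\<dots> = (\<Sum>i\<in>{1..n}. prob_above)"
    using step h_eq by (intro sum.cong) auto
  also have "\<dots> / real (n+1) = real n / real (n + 1) * prob_above" by simp
  finally show ?thesis .
qed

text \<open>The conditional law of a new score given the \<open>n\<close>-tuple \<open>T\<close>.\<close>
definition score_law :: "(nat \<Rightarrow> 'b) \<Rightarrow> real measure" where
  "score_law T = distr Q borel (\<lambda>z. c z T)"

lemma real_distribution_score_law:
  "T \<in> space (sample {1..n}) \<Longrightarrow> real_distribution (score_law T)"
  unfolding score_law_def by (intro real_distribution_distr c_measurable)

lemma cond_cdf_eq_cdf:
  assumes T: "T \<in> space (sample {1..n})" and na: "\<And>x. measure (score_law T) {x} = 0"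
  shows "cond_cdf T x = cdf (score_law T) x"
proof -
  interpret L: real_distribution "score_law T" using T by (rule real_distribution_score_law)
  have "cond_cdf T x = measure (score_law T) {..<x}"
    unfolding score_law_def cond_cdf_def using c_measurable[OF T]
    by (subst measure_distr) (auto intro: arg_cong[where f = "measure Q"])
  also have "\<dots> = measure (score_law T) ({..<x} \<union> {x})"
    using na[of x] by (subst L.finite_measure_Union) auto
  also have "{..<x} \<union> {x} = {..x}" by auto
  finally show ?thesis by (simp add: cdf_def)
qed

lemma upd_restrict: "T \<in> space (sample {1..n}) \<Longrightarrow> restrict (T(n+1 := z)) {1..n} = T"
  by (auto simp: space_PiM PiE_def extensional_def fun_eq_iff)

lemma upd_space: "T \<in> space (sample {1..n}) \<Longrightarrow> z \<in> space Q \<Longrightarrow> T(n+1 := z) \<in> space (sample {1..n+1})"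
  by (auto simp: space_PiM PiE_def extensional_def)

lemma loo_score_upd: "T \<in> space (sample {1..n}) \<Longrightarrow> loo_score (n+1) (T(n+1 := z)) = c z T"
  unfolding loo_score_last upd_restrict by simp

lemma pit_upd: "T \<in> space (sample {1..n}) \<Longrightarrow> pit (T(n+1 := z)) = cond_cdf T (c z T)"
  unfolding pit_def loo_score_upd upd_restrict ..

lemma inner_integral_pit_square:
  assumes T: "T \<in> space (sample {1..n})" and na: "\<And>x. measure (score_law T) {x} = 0"
  shows "(\<integral>z. (pit (T(n+1 := z)))\<^sup>2 \<partial>Q) = 1 / 3"
proof -
  interpret L: real_distribution "score_law T" using T by (rule real_distribution_score_law)
  note [measurable] = c_measurable[OF T]
  have "(\<integral>z. (pit (T(n+1 := z)))\<^sup>2 \<partial>Q) = (\<integral>z. (cdf (score_law T) (c z T))\<^sup>2 \<partial>Q)"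
    using na by (simp only: pit_upd[OF T] cond_cdf_eq_cdf[OF T])
  also have "\<dots> = (\<integral>x. (cdf (score_law T) x)\<^sup>2 \<partial>score_law T)"
    unfolding score_law_def[of T] by (subst integral_distr) (simp_all add: score_law_def[symmetric])
  also have "\<dots> = 1 / 3" using na by (intro L.integral_cdf_square) auto
  finally show ?thesis .
qed

text \<open>
  The hypothesis is stated for the inner integral because the set of tuples with this property is
  evidently measurable, unlike the set of tuples for which \<open>score_law\<close> has no atoms.
\<close>
lemma integral_pit_square:
  assumes "AE T in sample {1..n}. (\<integral>z. (pit (T(n+1 := z)))\<^sup>2 \<partial>Q) \<le> 1 / 3"
  shows "(\<integral>s. (pit s)\<^sup>2 \<partial>sample {1..n+1}) \<le> 1 / 3"
proof -
  have "(\<integral>s. (pit s)\<^sup>2 \<partial>sample {1..n+1}) =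
      (\<integral>T. (\<integral>z. (pit (T(n+1 := z)))\<^sup>2 \<partial>Q) \<partial>sample {1..n})"
    by (rule integral_sample_insert[where B = 1], measurable) (auto simp: pit_bounds power_le_one)
  also have "\<dots> \<le> (\<integral>T. 1 / 3 \<partial>sample {1..n})"
    using assms by (intro integral_mono_AE') auto
  finally show ?thesis by simp
qed

text \<open>
  The square is expanded; the three second moments are compared with \<open>1/3\<close>. The last summand comes
  from the factor \<open>n / (n + 1)\<close> in the mixed moment.
\<close>
lemma integral_rel_rank_minus_pit_square:
  assumes na: "AE T in sample {1..n}. (\<integral>z. (pit (T(n+1 := z)))\<^sup>2 \<partial>Q) \<le> 1 / 3"
  shows "(\<integral>s. (rel_rank s - pit s)\<^sup>2 \<partial>sample {1..n+1}) \<le>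
    2 * near_tie (2 * \<delta>) + 4 * instability (\<delta> / 2) + 1 / real (n + 1)"
proof -
  have i1: "integrable (sample {1..n+1}) (\<lambda>s. (rel_rank s)\<^sup>2)"
    by (rule integrable_bounded[where B = 1], measurable) (auto simp: rel_rank_bounds power_le_one)
  have i2: "integrable (sample {1..n+1}) (\<lambda>s. (pit s)\<^sup>2)"
    by (rule integrable_bounded[where B = 1], measurable) (auto simp: pit_bounds power_le_one)
  have i3: "integrable (sample {1..n+1}) (\<lambda>s. rel_rank s * pit s)"
    by (rule integrable_bounded[where B = 1], measurable) (auto simp: pit_bounds rel_rank_bounds abs_mult mult_le_one)
  have "(\<integral>s. (rel_rank s - pit s)\<^sup>2 \<partial>sample {1..n+1}) =
      (\<integral>s. (rel_rank s)\<^sup>2 + (pit s)\<^sup>2 - 2 * (rel_rank s * pit s) \<partial>sample {1..n+1})"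
    by (simp add: power2_diff mult.assoc)
  also have "\<dots> = (\<integral>s. (rel_rank s)\<^sup>2 \<partial>sample {1..n+1}) + (\<integral>s. (pit s)\<^sup>2 \<partial>sample {1..n+1})
      - 2 * (\<integral>s. rel_rank s * pit s \<partial>sample {1..n+1})"
    using i1 i2 i3 by simp
  also have "\<dots> \<le> 2 / 3 - 2 * (real n / real (n+1) * prob_above)"
    using integral_rel_rank_square integral_pit_square[OF na] unfolding integral_rel_rank_mult_pit by linarith
  also have "\<dots> \<le> 2 * near_tie (2 * \<delta>) + 4 * instability (\<delta> / 2) + 1 / real (n + 1)"
  proof -
    define e where "e = near_tie (2 * \<delta>) + 2 * instability (\<delta> / 2)"
    have e: "0 \<le> e" unfolding e_def near_tie_def instability_def by (intro add_nonneg_nonneg mult_nonneg_nonneg integral_nonneg) auto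
    have "real n / real (n+1) * (1/3 - e) \<le> real n / real (n+1) * prob_above"
      using prob_above_ge[of \<delta>] by (intro mult_left_mono) (auto simp: e_def)
    moreover have "real n / real (n+1) * (1/3 - e) \<ge> 1/3 - e - 1/3 * (1 / real (n+1))"
      using e by (simp add: field_simps)
    ultimately have "2/3 - 2 * (real n / real (n+1) * prob_above) \<le> 2 * e + 2/3 * (1 / real (n+1))"
      by linarith
    also have "\<dots> \<le> 2 * e + 1 / real (n+1)" by (simp add: field_simps)
    finally show ?thesis by (simp add: e_def)
  qed
  finally show ?thesis .
qed

section \<open>Deviation from uniformity given the sample\<close>
lemma upd_measurable: "(\<lambda>(T, z). T(m+1 := z)) \<in> sample {1..m} \<Otimes>\<^sub>M Q \<rightarrow>\<^sub>M sample {1..m+1}"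
proof -
  have "insert (m+1) {1..m} = {1..m+1}" by auto
  then show ?thesis using measurable_add_dim[of "m+1" "{1..m}" "\<lambda>_. Q"] by simp
qed

lemma inner_integral_measurable:
  fixes f :: "(nat \<Rightarrow> 'b) \<Rightarrow> real"
  assumes "f \<in> borel_measurable (sample {1..m+1})"
  shows "(\<lambda>T. \<integral>z. f (T(m+1 := z)) \<partial>Q) \<in> borel_measurable (sample {1..m})"
proof -
  have "(\<lambda>(T, z). f (T(m+1 := z))) \<in> borel_measurable (sample {1..m} \<Otimes>\<^sub>M Q)"
    using measurable_compose[OF upd_measurable assms] by (simp add: case_prod_beta)
  from borel_measurable_lebesgue_integral[OF this] show ?thesis by simp
qed

lemma measure_cond_cdf_ge:
  assumes T: "T \<in> space (sample {1..n})" and na: "\<And>x. measure (score_law T) {x} = 0"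
    and a: "0 \<le> a" "a \<le> 1"
  shows "measure Q {z \<in> space Q. a \<le> cond_cdf T (c z T)} = 1 - a"
proof -
  interpret L: real_distribution "score_law T" using T by (rule real_distribution_score_law)
  note [measurable] = c_measurable[OF T]
  have "1 - a = measure (score_law T) {x. a \<le> cdf (score_law T) x}"
    using L.measure_cdf_ge[OF na a] by simp
  also have "\<dots> = measure (distr Q borel (\<lambda>z. c z T)) {x \<in> space borel. a \<le> cdf (score_law T) x}"
    by (simp add: score_law_def[symmetric])
  also have "\<dots> = measure Q {z \<in> space Q. a \<le> cond_cdf T (c z T)}"
    by (subst measure_distr) (auto simp: cond_cdf_eq_cdf[OF T na] intro!: arg_cong[where f = "measure Q"])
  finally show ?thesis by simp
qed

text \<open>The conditional probability that relative rank and transform differ by more than \<open>\<epsilon>\<close>.\<close>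
definition far_prob :: "real \<Rightarrow> (nat \<Rightarrow> 'b) \<Rightarrow> real" where
  "far_prob \<epsilon> T = (\<integral>z. of_bool (\<bar>rel_rank (T(n+1 := z)) - pit (T(n+1 := z))\<bar> > \<epsilon>) \<partial>Q)"

lemma far_pred: "Measurable.pred (sample {1..n+1}) (\<lambda>s. \<bar>rel_rank s - pit s\<bar> > \<epsilon>)"
  by measurable

lemma far_prob_measurable: "far_prob \<epsilon> \<in> borel_measurable (sample {1..n})"
  unfolding far_prob_def by (intro inner_integral_measurable of_bool_measurable far_pred)

lemma far_prob_bounds: "0 \<le> far_prob \<epsilon> T" "far_prob \<epsilon> T \<le> 1"
  by (simp_all add: far_prob_def integral_of_bool_eq)

lemma integral_far_prob:
  assumes "\<epsilon> > 0"
  shows "(\<integral>T. far_prob \<epsilon> T \<partial>sample {1..n}) \<le> (\<integral>s. (rel_rank s - pit s)\<^sup>2 \<partial>sample {1..n+1}) / \<epsilon>\<^sup>2"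
proof -
  have abs_le: "\<bar>rel_rank s - pit s\<bar> \<le> 1" for s
    using rel_rank_bounds[of s] pit_bounds[of s] by linarith
  have "(\<integral>T. far_prob \<epsilon> T \<partial>sample {1..n}) = (\<integral>s. of_bool (\<bar>rel_rank s - pit s\<bar> > \<epsilon>) \<partial>sample {1..n+1})"
    unfolding far_prob_def
    by (rule integral_sample_insert[symmetric, where B = 1]) (intro of_bool_measurable far_pred, simp)
  also have "\<dots> \<le> (\<integral>s. (rel_rank s - pit s)\<^sup>2 / \<epsilon>\<^sup>2 \<partial>sample {1..n+1})"
  proof (rule integral_mono)
    show "integrable (sample {1..n+1}) (\<lambda>s. of_bool (\<bar>rel_rank s - pit s\<bar> > \<epsilon>) :: real)"
      by (rule integrable_bounded[where B = 1]) (intro of_bool_measurable far_pred, simp)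
    show "integrable (sample {1..n+1}) (\<lambda>s. (rel_rank s - pit s)\<^sup>2 / \<epsilon>\<^sup>2)"
    proof (rule integrable_bounded[where B = "1 / \<epsilon>\<^sup>2"])
      show "\<bar>(rel_rank s - pit s)\<^sup>2 / \<epsilon>\<^sup>2\<bar> \<le> 1 / \<epsilon>\<^sup>2" for s
        using abs_le[of s] by (auto intro!: divide_right_mono simp: abs_square_le_1)
    qed measurable
    fix s
    show "of_bool (\<bar>rel_rank s - pit s\<bar> > \<epsilon>) \<le> (rel_rank s - pit s)\<^sup>2 / \<epsilon>\<^sup>2"
    proof (cases "\<bar>rel_rank s - pit s\<bar> > \<epsilon>")
      case True
      then have "\<epsilon>\<^sup>2 \<le> (rel_rank s - pit s)\<^sup>2"
        using assms by (metis abs_le_square_iff abs_of_pos less_imp_le)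
      then show ?thesis using True assms by simp
    qed simp
  qed
  finally show ?thesis by simp
qed

text \<open>
  The transform has exactly uniform tails, so the tails of the relative rank are compared with those
  of the transform at a level shifted by \<open>\<epsilon>\<close>.
\<close>
lemma deviation_le:
  assumes T: "T \<in> space (sample {1..n})" and na: "\<And>x. measure (score_law T) {x} = 0"
    and \<epsilon>: "\<epsilon> > 0" and \<alpha>: "0 \<le> \<alpha>" "\<alpha> \<le> 1"
  shows "\<bar>measure Q {z \<in> space Q. 1 - \<alpha> \<le> rel_rank (T(n+1 := z))} - \<alpha>\<bar> \<le> \<epsilon> + far_prob \<epsilon> T"
proof -
  let ?A = "{z \<in> space Q. 1 - \<alpha> \<le> rel_rank (T(n+1 := z))}"
  let ?B = "{z \<in> space Q. \<bar>rel_rank (T(n+1 := z)) - pit (T(n+1 := z))\<bar> > \<epsilon>}"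
  let ?cond_cdf = "\<lambda>a. {z \<in> space Q. a \<le> cond_cdf T (c z T)}"
  have far_prob: "far_prob \<epsilon> T = measure Q ?B" by (simp add: far_prob_def integral_of_bool_eq)
  have upd: "(\<lambda>z. T(n+1 := z)) \<in> Q \<rightarrow>\<^sub>M sample {1..n+1}"
    using measurable_compose[OF measurable_Pair1'[OF T] upd_measurable] by simp
  have [measurable]: "(\<lambda>z. rel_rank (T(n+1 := z))) \<in> borel_measurable Q"
      "(\<lambda>z. pit (T(n+1 := z))) \<in> borel_measurable Q"
    by (rule measurable_compose[OF upd rel_rank_measurable] measurable_compose[OF upd pit_measurable])+
  have mF: "(\<lambda>z. cond_cdf T (c z T)) \<in> borel_measurable Q"
    using measurable_compose[OF upd pit_measurable] unfolding pit_upd[OF T] .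
  have sets: "?A \<in> events" "?B \<in> events" by measurable
  have setF: "?cond_cdf a \<in> events" for a using mF by measurable
  have close: "z \<in> ?B \<or> \<bar>rel_rank (T(n+1 := z)) - cond_cdf T (c z T)\<bar> \<le> \<epsilon>" if "z \<in> space Q" for z
    using that unfolding pit_upd[OF T] by (auto simp: not_less)
  have up: "prob ?A \<le> \<alpha> + \<epsilon> + prob ?B"
  proof (cases "0 \<le> 1 - \<alpha> - \<epsilon>")
    case True
    have "prob ?A \<le> prob (?cond_cdf (1 - \<alpha> - \<epsilon>) \<union> ?B)"
    proof (rule finite_measure_mono)
      show "?A \<subseteq> ?cond_cdf (1 - \<alpha> - \<epsilon>) \<union> ?B"
      proof
        fix z assume "z \<in> ?A"
        with close[of z] show "z \<in> ?cond_cdf (1 - \<alpha> - \<epsilon>) \<union> ?B" by (auto simp del: fun_upd_apply)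
      qed
    qed (use setF sets in auto)
    also have "\<dots> \<le> prob (?cond_cdf (1 - \<alpha> - \<epsilon>)) + prob ?B"
      by (rule measure_Un_le[OF setF sets(2)])
    also have "prob (?cond_cdf (1 - \<alpha> - \<epsilon>)) = 1 - (1 - \<alpha> - \<epsilon>)"
      using True \<alpha> \<epsilon> by (intro measure_cond_cdf_ge[OF T na]) auto
    finally show ?thesis by linarith
  next
    case False
    then show ?thesis using prob_le_1[of ?A] measure_nonneg[of Q ?B] by linarith
  qed
  have low: "\<alpha> - \<epsilon> \<le> prob ?A + prob ?B"
  proof (cases "\<epsilon> \<le> \<alpha>")
    case True
    have "\<alpha> - \<epsilon> = prob (?cond_cdf (1 - \<alpha> + \<epsilon>))"
      using True \<alpha> \<epsilon> by (subst measure_cond_cdf_ge[OF T na]) auto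
    also have "\<dots> \<le> prob (?A \<union> ?B)"
    proof (rule finite_measure_mono)
      show "?cond_cdf (1 - \<alpha> + \<epsilon>) \<subseteq> ?A \<union> ?B"
      proof
        fix z assume "z \<in> ?cond_cdf (1 - \<alpha> + \<epsilon>)"
        with close[of z] show "z \<in> ?A \<union> ?B" by (auto simp del: fun_upd_apply)
      qed
    qed (use sets in auto)
    also have "\<dots> \<le> prob ?A + prob ?B"
      by (rule measure_Un_le[OF sets])
    finally show ?thesis .
  next
    case False
    then show ?thesis using measure_nonneg[of Q ?A] measure_nonneg[of Q ?B] by linarith
  qed
  show ?thesis unfolding far_prob using up low by linarith
qed

text \<open>The conditional probability of a near tie given the \<open>n\<close>-tuple \<open>T\<close>.\<close>
definition tie_prob :: "real \<Rightarrow> (nat \<Rightarrow> 'b) \<Rightarrow> real" where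
  "tie_prob \<eta> T = (\<integral>z. (\<integral>z'. of_bool (\<bar>c z T - c z' T\<bar> \<le> \<eta>) \<partial>Q) \<partial>Q)"

lemma near_tie_eq_tie_prob:
  "tie_prob \<eta> \<in> borel_measurable (sample {1..n})" (is ?meas)
  "near_tie \<eta> = (\<integral>T. tie_prob \<eta> T \<partial>sample {1..n})" (is ?eq)
proof -
  define h where "h s = (of_bool (\<bar>pair_score (n+1) n s - pair_score (n+2) n s\<bar> \<le> \<eta>) :: real)" for s
  define k where "k s = (\<integral>z'. h (s(n+1+1 := z')) \<partial>Q)" for s
  define l where "l T = (\<integral>z. k (T(n+1 := z)) \<partial>Q)" for T
  have [measurable]: "pair_score (n+1) n \<in> borel_measurable (sample {1..n+1+1})"
      "pair_score (n+2) n \<in> borel_measurable (sample {1..n+1+1})"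
    using n_pos by (auto intro!: pair_score_measurable)
  have h: "h \<in> borel_measurable (sample {1..n+1+1})"
    unfolding h_def by (intro of_bool_measurable) measurable
  have k: "k \<in> borel_measurable (sample {1..n+1})"
    unfolding k_def by (rule inner_integral_measurable[OF h])
  have l: "l \<in> borel_measurable (sample {1..n})"
    unfolding l_def by (rule inner_integral_measurable[OF k])
  have k_bound: "\<bar>k s\<bar> \<le> 1" for s
    by (simp add: k_def h_def integral_of_bool_eq)
  have l_eq: "l T = tie_prob \<eta> T" if T: "T \<in> space (sample {1..n})" for T
  proof -
    have 1: "pair_score (n+1) n (T(n+1 := z, n+1+1 := z')) = c z T" for z z'
    proof -
      have "pair_score (n+1) n (T(n+1 := z, n+1+1 := z')) = loo_score (n+1) (T(n+1 := z))"
        unfolding loo_score_last_pair pair_score_def score_def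
        by (intro arg_cong2[where f = c] restrict_ext) auto
      then show ?thesis using loo_score_upd[OF T] by simp
    qed
    have 2: "pair_score (n+2) n (T(n+1 := z, n+1+1 := z')) = c z' T" for z z'
    proof -
      have "pair_score (n+2) n (T(n+1 := z, n+1+1 := z')) = c z' (restrict T {1..n})"
        unfolding pair_score_def score_def
        by (intro arg_cong2[where f = c] restrict_ext) auto
      also have "restrict T {1..n} = T"
        using T by (auto simp: space_PiM PiE_def extensional_def fun_eq_iff)
      finally show ?thesis .
    qed
    show ?thesis unfolding l_def k_def h_def 1 2 tie_prob_def ..
  qed
  show ?meas
    using l by (rule measurable_cong[THEN iffD1, rotated]) (rule l_eq)
  have "near_tie \<eta> = (\<integral>s. h s \<partial>sample {1..n+1+1})"
    by (simp add: near_tie_def h_def)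
  also have "\<dots> = (\<integral>s. k s \<partial>sample {1..n+1})"
    unfolding k_def by (rule integral_sample_insert[OF h, where B = 1]) (simp add: h_def)
  also have "\<dots> = (\<integral>T. l T \<partial>sample {1..n})"
    unfolding l_def by (rule integral_sample_insert[OF k k_bound])
  also have "\<dots> = (\<integral>T. tie_prob \<eta> T \<partial>sample {1..n})"
    by (intro Bochner_Integration.integral_cong l_eq refl)
  finally show ?eq .
qed

lemma tie_prob_bounds: "0 \<le> tie_prob \<eta> T" "tie_prob \<eta> T \<le> 1"
proof -
  show "0 \<le> tie_prob \<eta> T" by (auto simp: tie_prob_def intro!: integral_nonneg)
  have "tie_prob \<eta> T \<le> (\<integral>z. 1 \<partial>Q)"
    unfolding tie_prob_def by (rule integral_mono') (auto simp: integral_of_bool_eq)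
  then show "tie_prob \<eta> T \<le> 1" by (simp add: prob_space)
qed

lemma tie_prob_le:
  assumes T: "T \<in> space (sample {1..n})" and dens: "score_law T = density lborel (\<lambda>x. ennreal (f x))"
    and f: "(\<lambda>x. ennreal (f x)) \<in> borel_measurable borel" "\<And>x. 0 \<le> f x" "\<And>x. f x \<le> B" and \<eta>: "0 \<le> \<eta>"
  shows "tie_prob \<eta> T \<le> 2 * \<eta> * B"
proof -
  interpret L: real_distribution "score_law T" using T by (rule real_distribution_score_law)
  note [measurable] = c_measurable[OF T] f(1)
  have B: "0 \<le> B" using f(2,3)[of 0] by linarith
  have inner: "(\<integral>z'. of_bool (\<bar>x - c z' T\<bar> \<le> \<eta>) \<partial>Q) \<le> 2 * \<eta> * B" for x
  proof -
    have "(\<integral>z'. of_bool (\<bar>x - c z' T\<bar> \<le> \<eta>) \<partial>Q) = measure (score_law T) {x - \<eta>..x + \<eta>}"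
      unfolding integral_of_bool_eq score_law_def
      by (subst measure_distr) (auto intro!: arg_cong[where f = "measure Q"])
    also have "\<dots> \<le> 2 * \<eta> * B"
    proof -
      have "emeasure (score_law T) {x - \<eta>..x + \<eta>} = (\<integral>\<^sup>+y. ennreal (f y) * indicator {x - \<eta>..x + \<eta>} y \<partial>lborel)"
        unfolding dens by (subst emeasure_density) auto
      also have "\<dots> \<le> (\<integral>\<^sup>+y. ennreal B * indicator {x - \<eta>..x + \<eta>} y \<partial>lborel)"
        using f(3) by (intro nn_integral_mono mult_right_mono ennreal_leI) auto
      also have "\<dots> = ennreal (2 * \<eta> * B)"
        using \<eta> B by (simp add: nn_integral_cmult_indicator ennreal_mult'[symmetric] mult.commute)
      finally show ?thesis
        using \<eta> B by (simp add: L.emeasure_eq_measure)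
    qed
    finally show ?thesis .
  qed
  have "tie_prob \<eta> T \<le> (\<integral>z. 2 * \<eta> * B \<partial>Q)"
    unfolding tie_prob_def using inner \<eta> B by (intro integral_mono') auto
  then show ?thesis by (simp add: prob_space)
qed

end

section \<open>Non-coverage as a rank event\<close>

text \<open>
  A value \<open>v\<close> exceeds the quantile of a step function exactly when the step function has already
  reached the level \<open>b\<close> strictly before \<open>v\<close>.
\<close>
lemma quantile_less_iff:
  fixes u :: "'i \<Rightarrow> real"
  assumes I: "finite I" and a: "0 \<le> a" and F: "\<And>x. F x = a * (\<Sum>i\<in>I. of_bool (u i \<le> x))"
  shows "quantile F b < ereal v \<longleftrightarrow> b \<le> a * (\<Sum>i\<in>I. of_bool (u i < v))"
proof
  assume "quantile F b < ereal v"
  then obtain x where x: "b \<le> F x" "x < v"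
    by (auto simp: quantile_def Inf_less_iff)
  have "F x \<le> a * (\<Sum>i\<in>I. of_bool (u i < v))"
    unfolding F using a x(2) by (intro mult_left_mono sum_mono) auto
  with x(1) show "b \<le> a * (\<Sum>i\<in>I. of_bool (u i < v))" by linarith
next
  assume b: "b \<le> a * (\<Sum>i\<in>I. of_bool (u i < v))"
  \<comment> \<open>The largest jump point below \<open>v\<close>; \<open>v - 1\<close> is added in case there is none.\<close>
  define W where "W = insert (v - 1) (u ` {i \<in> I. u i < v})"
  have W: "finite W" "W \<noteq> {}" using I by (auto simp: W_def)
  have less: "Max W < v" using W by (auto simp: W_def)
  have "a * (\<Sum>i\<in>I. of_bool (u i < v)) \<le> F (Max W)"
    unfolding F
  proof (intro mult_left_mono sum_mono a)
    fix i assume "i \<in> I"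
    then show "(of_bool (u i < v) :: real) \<le> of_bool (u i \<le> Max W)"
      using W(1) by (auto simp: W_def intro!: Max_ge)
  qed
  with b have "b \<le> F (Max W)" by linarith
  then show "quantile F b < ereal v"
    using less by (auto simp: quantile_def Inf_less_iff)
qed

lemma noncoverage_eq:
  "noncoverage (obs_space Y p) Y C n \<alpha> 0 =
    {s \<in> space (tuple_space (n + 1) (obs_space Y p)).
      1 - \<alpha> \<le> (\<Sum>i\<in>{1..n+1}. of_bool (C n (s i) (remove_entry n i s) <
        C n (s (n+1)) (remove_entry n (n+1) s))) / real (n + 1)}"
proof -
  have "fst (s (n+1)) \<notin> PS_fc Y C n (restrict s {1..n}) (snd (s (n+1))) \<alpha> 0 \<longleftrightarrow>
      1 - \<alpha> \<le> (\<Sum>i\<in>{1..n+1}. of_bool (C n (s i) (remove_entry n i s) <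
        C n (s (n+1)) (remove_entry n (n+1) s))) / real (n + 1)"
    if s: "s \<in> space (tuple_space (n + 1) (obs_space Y p))" for s
  proof -
    define u where "u i = C n (s i) (remove_entry n i s)" for i
    let ?T = "restrict s {1..n}" and ?y = "fst (s (n+1))" and ?x = "snd (s (n+1))"
    have "s (n+1) \<in> space (obs_space Y p)"
      using s by (auto simp: tuple_space_def space_PiM)
    then have y: "?y \<in> Y"
      by (auto simp: obs_space_def space_pair_measure space_restrict_space)
    have last: "C n (?y, ?x) ?T = u (n+1)"
      by (auto simp: u_def remove_entry_def intro!: arg_cong2[where f = "C n"] restrict_ext)
    \<comment> \<open>At the observed response the augmented sample is the full sample.\<close>
    have upd: "?T(n + 1 := (?y, ?x)) = s"
      using s by (auto simp: tuple_space_def space_PiM PiE_def extensional_def fun_eq_iff)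
    have F: "Fhat C n ?T ?x ?y r = 1 / (real n + 1) * (\<Sum>i\<in>{1..n+1}. of_bool (u i \<le> r))" for r
    proof -
      have "(\<Sum>i=1..n. of_bool (C n (?T i) (remove_entry n i (?T(n + 1 := (?y, ?x)))) \<le> r)) =
          (\<Sum>i=1..n. of_bool (u i \<le> r) :: real)"
        unfolding upd by (intro sum.cong) (auto simp: u_def)
      then show ?thesis
        unfolding Fhat_def last by (simp add: distrib_left)
    qed
    have "?y \<notin> PS_fc Y C n ?T ?x \<alpha> 0 \<longleftrightarrow> quantile (Fhat C n ?T ?x ?y) (1 - \<alpha>) < ereal (u (n+1))"
    proof -
      have "?y \<notin> PS_fc Y C n ?T ?x \<alpha> 0 \<longleftrightarrow>
          \<not> ereal (C n (?y, ?x) ?T) \<le> quantile (Fhat C n ?T ?x ?y) (1 - \<alpha>) + ereal 0"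
        using y by (simp add: PS_fc_def)
      then show ?thesis unfolding last by (simp add: not_le zero_ereal_def[symmetric])
    qed
    also have "\<dots> \<longleftrightarrow> 1 - \<alpha> \<le> 1 / (real n + 1) * (\<Sum>i\<in>{1..n+1}. of_bool (u i < u (n+1)))"
      by (rule quantile_less_iff[OF _ _ F]) auto
    also have "1 / (real n + 1) * (\<Sum>i\<in>{1..n+1}. of_bool (u i < u (n+1))) =
        (\<Sum>i\<in>{1..n+1}. of_bool (u i < u (n+1))) / real (n+1)" by (simp add: add.commute)
    finally show ?thesis unfolding u_def .
  qed
  then show ?thesis unfolding noncoverage_def by blast
qed

section \<open>Conditional distributions given the sample\<close>
lemma tuple_restrict: "restrict (tuple (n+1) t \<omega>) {1..n} = tuple n t \<omega>"
  by (rule ext) (auto simp: tuple_def)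

text \<open>
  A sample on an arbitrary probability space together with a regular conditional distribution of
  its first \<open>n + 1\<close> entries given the first \<open>n\<close>. The spaces \<open>Sn\<close> and \<open>Sn1\<close> only serve as
  sigma-algebras.
\<close>
locale conditional_sample = score_sample Q n c c' + M: prob_space M
  for Q :: "'b measure" and n c c' and M :: "'a measure" +
  fixes t :: "nat \<Rightarrow> 'a \<Rightarrow> 'b" and K :: "(nat \<Rightarrow> 'b) \<Rightarrow> (nat \<Rightarrow> 'b) measure"
    and Sn :: "(nat \<Rightarrow> 'b) measure" and Sn1 :: "(nat \<Rightarrow> 'b) measure"
  assumes sets_Sn: "sets Sn = sets (sample {1..n})"
    and sets_Sn1: "sets Sn1 = sets (sample {1..n+1})"
    and t_iid: "iid M Q {1..n+1} t"
    and K: "regular_cond_distr M Sn (tuple n t) Sn1 (tuple (n+1) t) K"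
begin

lemma t_measurable: "i \<in> {1..n+1} \<Longrightarrow> t i \<in> M \<rightarrow>\<^sub>M Q"
  using t_iid by (auto simp: iid_def M.indep_vars_def)

lemma tuple_measurable: "m \<le> n + 1 \<Longrightarrow> tuple m t \<in> M \<rightarrow>\<^sub>M sample {1..m}"
  unfolding tuple_def by (intro measurable_restrict t_measurable) auto

lemma distr_tuple_full: "distr M (sample {1..n+1}) (tuple (n+1) t) = sample {1..n+1}"
proof -
  have "distr M (sample {1..n+1}) (tuple (n+1) t) = (\<Pi>\<^sub>M i\<in>{1..n+1}. distr M Q (t i))"
    using t_iid unfolding iid_def tuple_def
    by (subst M.indep_vars_iff_distr_eq_PiM'[symmetric]) (auto intro: t_measurable)
  also have "\<dots> = sample {1..n+1}"
    using t_iid by (intro PiM_cong) (auto simp: iid_def)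
  finally show ?thesis .
qed

lemma integral_tuple_full:
  fixes f :: "(nat \<Rightarrow> 'b) \<Rightarrow> real"
  assumes "f \<in> borel_measurable (sample {1..n+1})"
  shows "(\<integral>\<omega>. f (tuple (n+1) t \<omega>) \<partial>M) = (\<integral>s. f s \<partial>sample {1..n+1})"
  using integral_distr[OF tuple_measurable[OF order_refl] assms] unfolding distr_tuple_full by simp

lemma distr_tuple: "distr M (sample {1..n}) (tuple n t) = sample {1..n}"
proof -
  have "tuple n t = (\<lambda>s. \<lambda>j\<in>{1..n}. s j) \<circ> tuple (n+1) t"
    by (rule ext) (auto simp: tuple_def fun_eq_iff)
  then have "distr M (sample {1..n}) (tuple n t) =
      distr M (sample {1..n}) ((\<lambda>s. \<lambda>j\<in>{1..n}. s j) \<circ> tuple (n+1) t)"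
    by (rule arg_cong)
  also have "\<dots> = distr (distr M (sample {1..n+1}) (tuple (n+1) t)) (sample {1..n}) (\<lambda>s. \<lambda>j\<in>{1..n}. s j)"
    by (intro distr_distr[symmetric] tuple_measurable reindex_measurable order_refl) auto
  also have "\<dots> = sample {1..n}"
    unfolding distr_tuple_full
    using distr_PiM_reindex[of "{1..n+1}" "\<lambda>_. Q" "\<lambda>j. j" "{1..n}"] prob_space_axioms
    by (simp add: inj_on_def Pi_def del: One_nat_def)
  finally show ?thesis .
qed

lemma integral_tuple:
  fixes f :: "(nat \<Rightarrow> 'b) \<Rightarrow> real"
  assumes "f \<in> borel_measurable (sample {1..n})"
  shows "(\<integral>\<omega>. f (tuple n t \<omega>) \<partial>M) = (\<integral>s. f s \<partial>sample {1..n})"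
  using integral_distr[OF tuple_measurable assms] unfolding distr_tuple by simp

lemma AE_tuple:
  assumes "AE \<omega> in M. P (tuple n t \<omega>)" "{T \<in> space (sample {1..n}). P T} \<in> sets (sample {1..n})"
  shows "AE T in sample {1..n}. P T"
proof -
  have "AE T in distr M (sample {1..n}) (tuple n t). P T"
    by (subst AE_distr_iff) (use assms tuple_measurable[of n] in auto)
  then show ?thesis unfolding distr_tuple .
qed

lemma tuple_in_space: "m \<le> n + 1 \<Longrightarrow> \<omega> \<in> space M \<Longrightarrow> tuple m t \<omega> \<in> space (sample {1..m})"
  by (rule measurable_space[OF tuple_measurable])

lemma K_prob:
  assumes "\<omega> \<in> space M"
  shows "prob_space (K (tuple n t \<omega>))" "sets (K (tuple n t \<omega>)) = sets (sample {1..n+1})"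
proof -
  have "tuple n t \<omega> \<in> space Sn"
    using tuple_in_space[OF _ assms, of n] sets_eq_imp_space_eq[OF sets_Sn] by simp
  moreover have "K \<in> Sn \<rightarrow>\<^sub>M prob_algebra Sn1"
    using K by (simp add: regular_cond_distr_def)
  ultimately have "K (tuple n t \<omega>) \<in> space (prob_algebra Sn1)"
    by (rule measurable_space[rotated])
  then show "prob_space (K (tuple n t \<omega>))" "sets (K (tuple n t \<omega>)) = sets (sample {1..n+1})"
    by (auto simp: space_prob_algebra sets_Sn1)
qed

text \<open>Given \<open>T\<close>, the last observation is drawn independently from \<open>Q\<close>.\<close>
definition product_kernel :: "(nat \<Rightarrow> 'b) set \<Rightarrow> (nat \<Rightarrow> 'b) \<Rightarrow> real" where
  "product_kernel A T = measure Q {z \<in> space Q. T(n+1 := z) \<in> A}"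

text \<open>
  Only one event at a time: on each event both kernels are versions of the same conditional
  probability.
\<close>
lemma K_eq_product_kernel:
  assumes A: "A \<in> sets (sample {1..n+1})"
  shows "AE \<omega> in M. measure (K (tuple n t \<omega>)) A = product_kernel A (tuple n t \<omega>)"
proof -
  let ?X = "tuple n t" and ?V = "tuple (n+1) t"
  let ?G = "vimage_algebra (space M) ?X Sn"
  have X[measurable]: "?X \<in> M \<rightarrow>\<^sub>M sample {1..n}" by (rule tuple_measurable) simp
  have V[measurable]: "?V \<in> M \<rightarrow>\<^sub>M sample {1..n+1}" by (rule tuple_measurable) simp
  note [measurable] = A
  have sets_G: "sets ?G = {?X -` B \<inter> space M | B. B \<in> sets (sample {1..n})}"
    unfolding sets_Sn[symmetric]
    by (rule sets_vimage_algebra2)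
      (use measurable_space[OF X] sets_eq_imp_space_eq[OF sets_Sn] in auto)
  have sub: "subalgebra M ?G"
    unfolding subalgebra_def sets_G using measurable_sets[OF X] by auto
  interpret G: finite_measure_subalgebra M ?G
    by (unfold_locales) (rule sub)
  have ind: "(\<lambda>s. of_bool (s \<in> A) :: real) \<in> borel_measurable (sample {1..n+1})"
    by (intro of_bool_measurable) measurable
  have kernel_eq: "product_kernel A = (\<lambda>T. \<integral>z. of_bool (T(n+1 := z) \<in> A) \<partial>Q)"
    by (simp add: product_kernel_def[abs_def] integral_of_bool_eq)
  have k_meas[measurable]: "product_kernel A \<in> borel_measurable (sample {1..n})"
    unfolding kernel_eq by (rule inner_integral_measurable[OF ind])
  have k_bound: "\<bar>product_kernel A T\<bar> \<le> 1" for T by (simp add: product_kernel_def)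
  have "AE \<omega> in M. real_cond_exp M ?G (\<lambda>\<omega>. indicator A (?V \<omega>)) \<omega> = product_kernel A (?X \<omega>)"
  proof (rule G.real_cond_exp_charact)
    show "integrable M (\<lambda>\<omega>. indicator A (?V \<omega>) :: real)"
      by (rule M.integrable_const_bound[where B = 1]) (simp, measurable)
    show "integrable M (\<lambda>\<omega>. product_kernel A (?X \<omega>))"
      by (rule M.integrable_const_bound[where B = 1]) (use k_bound in auto)
    have "?X \<in> ?G \<rightarrow>\<^sub>M sample {1..n}"
      using measurable_vimage_algebra1[of ?X "space M" Sn] measurable_space[OF X]
      by (simp add: sets_eq_imp_space_eq[OF sets_Sn] measurable_cong_sets[OF refl sets_Sn])
    then show "(\<lambda>\<omega>. product_kernel A (?X \<omega>)) \<in> borel_measurable ?G"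
      by (rule measurable_compose[OF _ k_meas])
  next
    fix D assume "D \<in> sets ?G"
    then obtain B where B[measurable]: "B \<in> sets (sample {1..n})" and D: "D = ?X -` B \<inter> space M"
      unfolding sets_G by auto
    define f where "f s = (of_bool (restrict s {1..n} \<in> B \<and> s \<in> A) :: real)" for s
    have res: "(\<lambda>s. restrict s {1..n}) \<in> sample {1..n+1} \<rightarrow>\<^sub>M sample {1..n}"
      by (intro measurable_restrict_subset) auto
    have f: "f \<in> borel_measurable (sample {1..n+1})"
      unfolding f_def using res by (intro of_bool_measurable) measurable
    have "(\<integral>\<omega>\<in>D. indicator A (?V \<omega>) \<partial>M) = (\<integral>\<omega>. f (?V \<omega>) \<partial>M)"
      unfolding set_lebesgue_integral_def
      by (intro Bochner_Integration.integral_cong refl)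
        (auto simp: f_def D tuple_restrict indicator_def simp del: One_nat_def)
    also have "\<dots> = (\<integral>s. f s \<partial>sample {1..n+1})" by (rule integral_tuple_full[OF f])
    also have "\<dots> = (\<integral>T. (\<integral>z. f (T(n+1 := z)) \<partial>Q) \<partial>sample {1..n})"
      by (rule integral_sample_insert[OF f, where B = 1]) (simp add: f_def)
    also have "\<dots> = (\<integral>T. indicator B T * product_kernel A T \<partial>sample {1..n})"
    proof (rule Bochner_Integration.integral_cong[OF refl])
      fix T assume T: "T \<in> space (sample {1..n})"
      have "f (T(n+1 := z)) = indicator B T * of_bool (T(n+1 := z) \<in> A)" for z
        unfolding f_def upd_restrict[OF T] by (simp add: indicator_def)
      then show "(\<integral>z. f (T(n+1 := z)) \<partial>Q) = indicator B T * product_kernel A T"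
        unfolding kernel_eq by simp
    qed
    also have "\<dots> = (\<integral>\<omega>. indicator B (?X \<omega>) * product_kernel A (?X \<omega>) \<partial>M)"
      by (rule integral_tuple[symmetric]) measurable
    also have "\<dots> = (\<integral>\<omega>\<in>D. product_kernel A (?X \<omega>) \<partial>M)"
      unfolding set_lebesgue_integral_def
      by (intro Bochner_Integration.integral_cong refl) (auto simp: D indicator_def)
    finally show "(\<integral>\<omega>\<in>D. indicator A (?V \<omega>) \<partial>M) = (\<integral>\<omega>\<in>D. product_kernel A (?X \<omega>) \<partial>M)" .
  qed
  moreover have "AE \<omega> in M. measure (K (?X \<omega>)) A =
      real_cond_exp M ?G (\<lambda>\<omega>. indicator A (?V \<omega>)) \<omega>"
    using K A by (auto simp: regular_cond_distr_def sets_Sn1)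
  ultimately show ?thesis by eventually_elim simp
qed

text \<open>
  The law of the new score under \<open>K\<close> and its law under the product kernel have almost surely the same
  distribution function at all rationals, hence coincide.
\<close>
lemma score_law_eq_density:
  assumes f: "AE \<omega> in M. distributed (K (tuple n t \<omega>)) lborel (\<lambda>s. c (s (n+1)) (restrict s {1..n}))
      (\<lambda>x. ennreal (f (tuple n t \<omega>) x))"
  shows "AE \<omega> in M. score_law (tuple n t \<omega>) = density lborel (\<lambda>x. ennreal (f (tuple n t \<omega>) x))"
proof -
  define A where "A q = {s \<in> space (sample {1..n+1}). loo_score (n+1) s \<le> q}" for q
  have loo_score: "loo_score (n+1) \<in> borel_measurable (sample {1..n+1})" by (rule loo_score_measurable') simp
  have A: "A q \<in> sets (sample {1..n+1})" for q
    unfolding A_def using loo_score by measurable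
  have "AE \<omega> in M. \<forall>q\<in>\<rat>. measure (K (tuple n t \<omega>)) (A q) = product_kernel (A q) (tuple n t \<omega>)"
    using K_eq_product_kernel[OF A] by (intro AE_ball_countable') (auto simp: countable_rat)
  then show ?thesis using f AE_space
  proof eventually_elim
    case (elim \<omega>)
    let ?T = "tuple n t \<omega>"
    have T: "?T \<in> space (sample {1..n})" using tuple_in_space elim by simp
    interpret KT: prob_space "K ?T" using K_prob elim by simp
    have setsK: "sets (K ?T) = sets (sample {1..n+1})" using K_prob elim by simp
    have spaceK: "space (K ?T) = space (sample {1..n+1})" using setsK by (rule sets_eq_imp_space_eq)
    have UK: "loo_score (n+1) \<in> borel_measurable (K ?T)"
      using loo_score measurable_cong_sets[OF setsK refl] by blast
    have dens: "density lborel (\<lambda>x. ennreal (f ?T x)) = distr (K ?T) borel (loo_score (n+1))"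
    proof -
      have "density lborel (\<lambda>x. ennreal (f ?T x)) = distr (K ?T) lborel (\<lambda>s. c (s (n+1)) (restrict s {1..n}))"
        using elim(2) by (rule distributed_distr_eq_density[symmetric])
      also have "\<dots> = distr (K ?T) borel (loo_score (n+1))"
        by (intro distr_cong) (auto simp: loo_score_last simp del: One_nat_def)
      finally show ?thesis .
    qed
    have "score_law ?T = distr (K ?T) borel (loo_score (n+1))"
    proof (rule real_distribution_eqI_rat)
      show "real_distribution (score_law ?T)" using T by (rule real_distribution_score_law)
      show "real_distribution (distr (K ?T) borel (loo_score (n+1)))"
        using UK by (rule KT.real_distribution_distr)
      fix q :: real assume q: "q \<in> \<rat>"
      have "cdf (score_law ?T) q = measure Q {z \<in> space Q. c z ?T \<le> q}"
        unfolding cdf_def score_law_def using c_measurable[OF T]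
        by (subst measure_distr) (auto intro!: arg_cong[where f = "measure Q"])
      also have "\<dots> = product_kernel (A q) ?T"
        unfolding product_kernel_def A_def using upd_space[OF T] loo_score_upd[OF T]
        by (auto intro!: arg_cong[where f = "measure Q"] simp del: fun_upd_apply)
      also have "\<dots> = measure (K ?T) (A q)" using elim(1) q by simp
      also have "\<dots> = cdf (distr (K ?T) borel (loo_score (n+1))) q"
        unfolding cdf_def A_def using UK
        by (subst measure_distr) (auto simp: spaceK intro!: arg_cong[where f = "measure (K ?T)"])
      finally show "cdf (score_law ?T) q = cdf (distr (K ?T) borel (loo_score (n+1))) q" .
    qed
    then show ?case using dens by simp
  qed
qed

section \<open>Asymptotic conditional validity\<close>

text \<open>
  Since the rank is a multiple of \<open>1 / (n + 1)\<close>, the events \<open>a \<le> rel_rank s\<close>, for real \<open>a\<close>, form a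
  countable family.
\<close>
lemma rel_rank_ge_iff:
  "a \<le> rel_rank s \<longleftrightarrow> real (nat \<lceil>a * real (n+1)\<rceil>) / real (n+1) \<le> rel_rank s"
proof -
  define j where "j = (\<Sum>i\<in>{1..n+1}. of_bool (loo_score i s < loo_score (n+1) s) :: nat)"
  have r: "rel_rank s = real j / real (n+1)"
    by (simp add: rel_rank_def j_def del: sum.cl_ivl_Suc)
  have "a \<le> rel_rank s \<longleftrightarrow> a * real (n+1) \<le> real j"
    unfolding r by (subst pos_le_divide_eq) auto
  also have "\<dots> \<longleftrightarrow> real (nat \<lceil>a * real (n+1)\<rceil>) \<le> real j"
    by (simp only: of_nat_le_iff nat_ceiling_le_eq)
  also have "\<dots> \<longleftrightarrow> real (nat \<lceil>a * real (n+1)\<rceil>) / real (n+1) \<le> rel_rank s"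
    unfolding r by (subst divide_le_cancel) auto
  finally show ?thesis .
qed

text \<open>
  The distance from uniformity, over \<open>\<alpha> \<in> [0, 1]\<close>, of the conditional law of the rank. Its
  measurability is not needed: the Bochner integral of a non-integrable function is \<open>0\<close>, so that the
  upper bounds below hold in this case as well.
\<close>
definition deviation :: "'a \<Rightarrow> real" where
  "deviation \<omega> = (SUP \<alpha>\<in>{0..1}.
     \<bar>measure (K (tuple n t \<omega>)) {s \<in> space (sample {1..n+1}). 1 - \<alpha> \<le> rel_rank s} - \<alpha>\<bar>)"

lemma integral_deviation_nonneg: "0 \<le> (\<integral>\<omega>. deviation \<omega> \<partial>M)"
proof (rule integral_nonneg_AE, rule AE_I2)
  fix \<omega> assume "\<omega> \<in> space M"
  then interpret KT: prob_space "K (tuple n t \<omega>)" by (rule K_prob)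
  have m: "0 \<le> KT.prob A" "KT.prob A \<le> 1" for A by auto
  show "0 \<le> deviation \<omega>"
    unfolding deviation_def
  proof (rule cSUP_upper2[of _ _ 0])
    show "bdd_above ((\<lambda>\<alpha>. \<bar>KT.prob {s \<in> space (sample {1..n+1}). 1 - \<alpha> \<le> rel_rank s} - \<alpha>\<bar>) ` {0..1})"
    proof (rule bdd_aboveI2[where M = 1])
      fix \<alpha> :: real assume "\<alpha> \<in> {0..1}"
      then show "\<bar>KT.prob {s \<in> space (sample {1..n+1}). 1 - \<alpha> \<le> rel_rank s} - \<alpha>\<bar> \<le> 1"
        using m[of "{s \<in> space (sample {1..n+1}). 1 - \<alpha> \<le> rel_rank s}"] by (simp only: atLeastAtMost_iff) linarith
    qed
  qed auto
qed

text \<open>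
  A quantitative form of the theorem for fixed \<open>n\<close>: \<open>B\<close> bounds the conditional density outside an event
  of probability at most \<open>p\<close>.
\<close>
lemma integral_deviation_le:
  assumes f: "AE \<omega> in M. (\<forall>x. 0 \<le> f (tuple n t \<omega>) x) \<and>
      distributed (K (tuple n t \<omega>)) lborel (\<lambda>s. c (s (n+1)) (restrict s {1..n}))
        (\<lambda>x. ennreal (f (tuple n t \<omega>) x))"
    and meas: "(\<lambda>\<omega>. SUP x. ennreal \<bar>f (tuple n t \<omega>) x\<bar>) \<in> borel_measurable M"
    and B: "0 \<le> B" and p: "measure M {\<omega> \<in> space M. (SUP x. ennreal \<bar>f (tuple n t \<omega>) x\<bar>) > ennreal B} \<le> p"
    and \<epsilon>: "0 < \<epsilon>" and \<delta>: "0 < \<delta>"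
  shows "(\<integral>\<omega>. deviation \<omega> \<partial>M) \<le>
    \<epsilon> + (8 * \<delta> * B + 2 * p + 4 * instability (\<delta> / 2) + 1 / real (n + 1)) / \<epsilon>\<^sup>2"
proof -
  let ?T = "tuple n t"
  let ?H = "\<lambda>\<omega>. (SUP x. ennreal \<bar>f (?T \<omega>) x\<bar>) > ennreal B"
  have dens: "AE \<omega> in M. score_law (?T \<omega>) = density lborel (\<lambda>x. ennreal (f (?T \<omega>) x))"
    by (rule score_law_eq_density) (use f in eventually_elim, simp)
  have fm: "AE \<omega> in M. (\<lambda>x. ennreal (f (?T \<omega>) x)) \<in> borel_measurable borel"
    using f by eventually_elim (auto simp: distributed_def)
  have na: "AE \<omega> in M. \<forall>x. measure (score_law (?T \<omega>)) {x} = 0"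
    using dens fm
  proof eventually_elim
    case (elim \<omega>)
    have "emeasure (score_law (?T \<omega>)) {x} = 0" for x
    proof -
      have "emeasure (score_law (?T \<omega>)) {x} = (\<integral>\<^sup>+y. ennreal (f (?T \<omega>) y) * indicator {x} y \<partial>lborel)"
        unfolding elim(1) using elim(2) by (subst emeasure_density) auto
      also have "\<dots> = (\<integral>\<^sup>+(y::real). 0 \<partial>lborel)"
        by (rule nn_integral_cong_AE, use AE_lborel_singleton[of x] in eventually_elim) auto
      finally show ?thesis by simp
    qed
    then show ?case by (simp add: measure_def)
  qed
  have pit_square: "AE T in sample {1..n}. (\<integral>z. (pit (T(n+1 := z)))\<^sup>2 \<partial>Q) \<le> 1 / 3"
  proof (rule AE_tuple)
    show "AE \<omega> in M. (\<integral>z. (pit ((?T \<omega>)(n+1 := z)))\<^sup>2 \<partial>Q) \<le> 1 / 3"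
      using na AE_space
    proof eventually_elim
      case (elim \<omega>)
      then show ?case
        using inner_integral_pit_square[OF tuple_in_space[of n \<omega>]] by (simp del: fun_upd_apply)
    qed
    have "(\<lambda>s. (pit s)\<^sup>2) \<in> borel_measurable (sample {1..n+1})" by measurable
    from inner_integral_measurable[OF this]
    show "{T \<in> space (sample {1..n}). (\<integral>z. (pit (T(n+1 := z)))\<^sup>2 \<partial>Q) \<le> 1 / 3} \<in> sets (sample {1..n})"
      by measurable
  qed
  have "near_tie (2 * \<delta>) = (\<integral>\<omega>. tie_prob (2 * \<delta>) (?T \<omega>) \<partial>M)"
    unfolding near_tie_eq_tie_prob(2) by (rule integral_tuple[symmetric, OF near_tie_eq_tie_prob(1)])
  also have "\<dots> \<le> (\<integral>\<omega>. 4 * \<delta> * B + indicator {\<omega> \<in> space M. ?H \<omega>} \<omega> \<partial>M)"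
  proof (rule integral_mono_AE)
    have "(\<lambda>\<omega>. tie_prob (2 * \<delta>) (?T \<omega>)) \<in> borel_measurable M"
      by (rule measurable_compose[OF tuple_measurable near_tie_eq_tie_prob(1)]) simp
    then show "integrable M (\<lambda>\<omega>. tie_prob (2 * \<delta>) (?T \<omega>))"
      by (intro M.integrable_const_bound[where B = 1]) (auto simp: tie_prob_bounds)
    show "integrable M (\<lambda>\<omega>. 4 * \<delta> * B + indicator {\<omega> \<in> space M. ?H \<omega>} \<omega> :: real)"
      using meas by (intro Bochner_Integration.integrable_add M.integrable_const integrable_real_indicator)
        (auto simp: less_top[symmetric])
    show "AE \<omega> in M. tie_prob (2 * \<delta>) (?T \<omega>) \<le> 4 * \<delta> * B + indicator {\<omega> \<in> space M. ?H \<omega>} \<omega>"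
      using f dens fm AE_space
    proof eventually_elim
      case (elim \<omega>)
      have T: "?T \<omega> \<in> space (sample {1..n})" using tuple_in_space elim by simp
      show ?case
      proof (cases "?H \<omega>")
        case True
        then show ?thesis
          using elim tie_prob_bounds(2)[of "2 * \<delta>" "?T \<omega>"] B \<delta> by (simp add: add_increasing)
      next
        case False
        have "f (?T \<omega>) x \<le> B" for x
        proof -
          have "ennreal \<bar>f (?T \<omega>) x\<bar> \<le> (SUP x. ennreal \<bar>f (?T \<omega>) x\<bar>)" by (rule SUP_upper) simp
          also have "\<dots> \<le> ennreal B" using False by simp
          finally show ?thesis using B by simp
        qed
        then have "tie_prob (2 * \<delta>) (?T \<omega>) \<le> 2 * (2 * \<delta>) * B"
          using elim \<delta> by (intro tie_prob_le[OF T elim(2)]) auto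
        then show ?thesis using False by simp
      qed
    qed
  qed
  also have "\<dots> = 4 * \<delta> * B + measure M {\<omega> \<in> space M. ?H \<omega>}"
    using meas by (subst Bochner_Integration.integral_add)
      (auto simp: M.prob_space less_top[symmetric] intro!: integrable_real_indicator arg_cong[where f = "measure M"])
  finally have tie_prob: "near_tie (2 * \<delta>) \<le> 4 * \<delta> * B + p" using p by linarith
  define A where "A k = {s \<in> space (sample {1..n+1}). real k / real (n+1) \<le> rel_rank s}" for k :: nat
  have A_sets: "A k \<in> sets (sample {1..n+1})" for k
    unfolding A_def by measurable
  have "AE \<omega> in M. \<forall>k. measure (K (?T \<omega>)) (A k) = product_kernel (A k) (?T \<omega>)"
    using K_eq_product_kernel[OF A_sets] by (simp add: AE_all_countable)
  then have dev: "AE \<omega> in M. deviation \<omega> \<le> \<epsilon> + far_prob \<epsilon> (?T \<omega>)"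
    using na AE_space
  proof eventually_elim
    case (elim \<omega>)
    have T: "?T \<omega> \<in> space (sample {1..n})" using tuple_in_space elim by simp
    show ?case unfolding deviation_def
    proof (rule cSUP_least)
      fix \<alpha> :: real assume \<alpha>: "\<alpha> \<in> {0..1}"
      define k where "k = nat \<lceil>(1 - \<alpha>) * real (n+1)\<rceil>"
      have Ak: "{s \<in> space (sample {1..n+1}). 1 - \<alpha> \<le> rel_rank s} = A k"
        unfolding A_def k_def using rel_rank_ge_iff[of "1 - \<alpha>"] by blast
      have "product_kernel (A k) (?T \<omega>) = measure Q {z \<in> space Q. 1 - \<alpha> \<le> rel_rank ((?T \<omega>)(n+1 := z))}"
        unfolding product_kernel_def Ak[symmetric] using upd_space[OF T] by (intro arg_cong[where f = "measure Q"]) blast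
      then show "\<bar>measure (K (?T \<omega>)) {s \<in> space (sample {1..n+1}). 1 - \<alpha> \<le> rel_rank s} - \<alpha>\<bar> \<le> \<epsilon> + far_prob \<epsilon> (?T \<omega>)"
        unfolding Ak using elim \<alpha> deviation_le[OF T _ \<epsilon>, of \<alpha>] by simp
    qed simp
  qed
  have far_prob_int: "integrable M (\<lambda>\<omega>. far_prob \<epsilon> (?T \<omega>))"
    using measurable_compose[OF tuple_measurable far_prob_measurable]
    by (intro M.integrable_const_bound[where B = 1]) (auto simp: far_prob_bounds)
  have "(\<integral>\<omega>. deviation \<omega> \<partial>M) \<le> (\<integral>\<omega>. \<epsilon> + far_prob \<epsilon> (?T \<omega>) \<partial>M)"
  proof (rule integral_mono_AE')
    show "AE \<omega> in M. 0 \<le> \<epsilon> + far_prob \<epsilon> (?T \<omega>)"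
      using \<epsilon> by (auto intro!: AE_I2 add_nonneg_nonneg far_prob_bounds)
  qed (use far_prob_int dev in auto)
  also have "\<dots> = \<epsilon> + (\<integral>T. far_prob \<epsilon> T \<partial>sample {1..n})"
    using far_prob_int by (simp add: M.prob_space integral_tuple[OF far_prob_measurable])
  also have "\<dots> \<le> \<epsilon> + (8 * \<delta> * B + 2 * p + 4 * instability (\<delta> / 2) + 1 / real (n + 1)) / \<epsilon>\<^sup>2"
  proof -
    have "(\<integral>T. far_prob \<epsilon> T \<partial>sample {1..n}) \<le> (\<integral>s. (rel_rank s - pit s)\<^sup>2 \<partial>sample {1..n+1}) / \<epsilon>\<^sup>2"
      by (rule integral_far_prob[OF \<epsilon>])
    also have "\<dots> \<le> (8 * \<delta> * B + 2 * p + 4 * instability (\<delta> / 2) + 1 / real (n + 1)) / \<epsilon>\<^sup>2"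
      using integral_rel_rank_minus_pit_square[OF pit_square, of \<delta>] tie_prob by (intro divide_right_mono) auto
    finally show ?thesis by simp
  qed
  finally show ?thesis .
qed

lemma instability_eq_prob:
  "instability \<eta> = measure M {\<omega> \<in> space M. \<bar>c (t (n+1) \<omega>) (tuple n t \<omega>) -
     c' (t (n+1) \<omega>) (remove_entry (n-1) n (tuple n t \<omega>))\<bar> > \<eta>}"
proof -
  let ?f = "\<lambda>s. of_bool (\<bar>pair_score (n+1) n s - base_score (n+1) s\<bar> > \<eta>) :: real"
  have [measurable]: "pair_score (n+1) n \<in> borel_measurable (sample {1..n+1})"
      "base_score (n+1) \<in> borel_measurable (sample {1..n+1})"
    using n_pos by (auto intro!: pair_score_measurable base_score_measurable)
  have "instability \<eta> = (\<integral>\<omega>. ?f (tuple (n+1) t \<omega>) \<partial>M)"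
    unfolding instability_def by (rule integral_tuple_full[symmetric]) measurable
  also have "\<dots> = (\<integral>\<omega>. indicator {\<omega> \<in> space M. \<bar>c (t (n+1) \<omega>) (tuple n t \<omega>) -
     c' (t (n+1) \<omega>) (remove_entry (n-1) n (tuple n t \<omega>))\<bar> > \<eta>} \<omega> \<partial>M)"
  proof (rule Bochner_Integration.integral_cong[OF refl])
    fix \<omega> assume \<omega>: "\<omega> \<in> space M"
    have 1: "pair_score (n+1) n (tuple (n+1) t \<omega>) = c (t (n+1) \<omega>) (tuple n t \<omega>)"
      unfolding loo_score_last_pair[symmetric] loo_score_last tuple_restrict by (simp add: tuple_def)
    have 2: "restrict (tuple (n+1) t \<omega>) {1..n-1} = remove_entry (n-1) n (tuple n t \<omega>)"
      by (auto simp: tuple_def remove_entry_def fun_eq_iff)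
    have 3: "base_score (n+1) (tuple (n+1) t \<omega>) = c' (t (n+1) \<omega>) (remove_entry (n-1) n (tuple n t \<omega>))"
      unfolding base_score_def 2 by (simp add: tuple_def)
    show "?f (tuple (n+1) t \<omega>) = indicator {\<omega> \<in> space M. \<bar>c (t (n+1) \<omega>) (tuple n t \<omega>) -
     c' (t (n+1) \<omega>) (remove_entry (n-1) n (tuple n t \<omega>))\<bar> > \<eta>} \<omega>"
      unfolding 1 3 using \<omega> by simp
  qed
  also have "\<dots> = measure M {\<omega> \<in> space M. \<bar>c (t (n+1) \<omega>) (tuple n t \<omega>) -
     c' (t (n+1) \<omega>) (remove_entry (n-1) n (tuple n t \<omega>))\<bar> > \<eta>}"
    by (auto intro!: arg_cong[where f = "measure M"])
  finally show ?thesis .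
qed

end

theorem theorem3p9:
  fixes Y :: "nat \<Rightarrow> real set"
    and p :: "nat \<Rightarrow> nat"
    and P :: "nat \<Rightarrow> obs measure"
    and M :: "nat \<Rightarrow> 'a measure"
    and t :: "nat \<Rightarrow> nat \<Rightarrow> 'a \<Rightarrow> obs"
    and K :: "nat \<Rightarrow> (nat \<Rightarrow> obs) \<Rightarrow> (nat \<Rightarrow> obs) measure"
    and C :: "nat \<Rightarrow> nat \<Rightarrow> obs \<Rightarrow> (nat \<Rightarrow> obs) \<Rightarrow> real"
  assumes interval: "\<And>n. n \<ge> 1 \<Longrightarrow> is_interval (Y n)"
    and P_prob: "\<And>n. n \<ge> 1 \<Longrightarrow> prob_space (P n)"
    and P_sets: "\<And>n. n \<ge> 1 \<Longrightarrow> sets (P n) = sets (obs_space (Y n) (p n))"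
    and M_prob: "\<And>n. n \<ge> 1 \<Longrightarrow> prob_space (M n)"
    and t_iid: "\<And>n. n \<ge> 1 \<Longrightarrow> iid (M n) (P n) {1..n + 1} (t n)"
    and K_cond: "\<And>n. n \<ge> 1 \<Longrightarrow>
      regular_cond_distr (M n)
        (tuple_space n (obs_space (Y n) (p n))) (tuple n (t n))
        (tuple_space (n + 1) (obs_space (Y n) (p n))) (tuple (n + 1) (t n)) (K n)"
    and scores: "conformity_scores (\<lambda>n. obs_space (Y n) (p n)) C"
    and stable: "stable_scores M t C"
    and bounded: "stochastically_bounded M
      (\<lambda>n \<omega>. ennreal \<bar>C n n (t n (n + 1) \<omega>) (tuple n (t n) \<omega>)\<bar>)"
    and CC: "continuous_case M t K C"
  shows "(\<lambda>n. \<integral>\<omega>. (SUP \<alpha>\<in>{0..1}.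
           \<bar>measure (K n (tuple n (t n) \<omega>)) (noncoverage (obs_space (Y n) (p n)) (Y n) (C n) n \<alpha> 0)
              - \<alpha>\<bar>) \<partial>M n) \<longlonglongrightarrow> 0"
proof -
  define D where "D n = (\<integral>\<omega>. (SUP \<alpha>\<in>{0..1}.
      \<bar>measure (K n (tuple n (t n) \<omega>)) (noncoverage (obs_space (Y n) (p n)) (Y n) (C n) n \<alpha> 0)
        - \<alpha>\<bar>) \<partial>M n)" for n
  define V where "V n \<omega> = C n n (t n (n + 1) \<omega>) (tuple n (t n) \<omega>) -
      C n (n - 1) (t n (n + 1) \<omega>) (remove_entry (n - 1) n (tuple n (t n) \<omega>))" for n \<omega>
  from CC obtain f :: "nat \<Rightarrow> (nat \<Rightarrow> obs) \<Rightarrow> real \<Rightarrow> real" where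
    f: "\<And>n. n \<ge> 1 \<Longrightarrow> AE \<omega> in M n. (\<forall>x. 0 \<le> f n (tuple n (t n) \<omega>) x) \<and>
        distributed (K n (tuple n (t n) \<omega>)) lborel
          (\<lambda>s. C n n (s (n + 1)) (restrict s {1..n})) (\<lambda>x. ennreal (f n (tuple n (t n) \<omega>) x))"
    and f_bounded: "stochastically_bounded M (\<lambda>n \<omega>. SUP x. ennreal \<bar>f n (tuple n (t n) \<omega>) x\<bar>)"
    unfolding continuous_case_def by blast
  have f_meas: "(\<lambda>\<omega>. SUP x. ennreal \<bar>f n (tuple n (t n) \<omega>) x\<bar>) \<in> borel_measurable (M n)"
    if "n \<ge> 1" for n
    using f_bounded that unfolding stochastically_bounded_def by blast

  have bound: "0 \<le> D n \<and> D n \<le> \<epsilon> + (8 * \<delta> * B + 2 * q +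
      4 * measure (M n) {\<omega> \<in> space (M n). \<bar>V n \<omega>\<bar> > \<delta> / 2} + 1 / real (n + 1)) / \<epsilon>\<^sup>2"
    if n: "n \<ge> 2" and pos: "\<epsilon> > 0" "\<delta> > 0" "B \<ge> 0"
      and q: "measure (M n) {\<omega> \<in> space (M n). (SUP x. ennreal \<bar>f n (tuple n (t n) \<omega>) x\<bar>) > ennreal B} \<le> q"
    for n and \<epsilon> \<delta> B q :: real
  proof -
    have n1: "n \<ge> 1" "n - 1 \<ge> 1" using n by auto
    let ?Z = "obs_space (Y n) (p n)"
    have sets_tuple: "sets (tuple_space m ?Z) = sets (\<Pi>\<^sub>M i\<in>{1..m}. P n)" for m
      unfolding tuple_space_def by (intro sets_PiM_cong refl P_sets[OF n1(1), symmetric])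
    have sc: "(\<lambda>(z, E). C n m z E) \<in> borel_measurable (P n \<Otimes>\<^sub>M (\<Pi>\<^sub>M i\<in>{1..m}. P n))"
      if "m \<ge> 1" for m
    proof -
      have "(\<lambda>(z, E). C n m z E) \<in> borel_measurable (?Z \<Otimes>\<^sub>M tuple_space m ?Z)"
        using scores n1(1) that by (simp add: conformity_scores_def)
      moreover have "sets (?Z \<Otimes>\<^sub>M tuple_space m ?Z) = sets (P n \<Otimes>\<^sub>M (\<Pi>\<^sub>M i\<in>{1..m}. P n))"
        by (intro sets_pair_measure_cong P_sets[OF n1(1), symmetric] sets_tuple)
      ultimately show ?thesis using measurable_cong_sets by blast
    qed
    have sym: "C n n z (E \<circ> \<pi>) = C n n z E"
      if "z \<in> space (P n)" "E \<in> space (\<Pi>\<^sub>M i\<in>{1..n}. P n)" "\<pi> permutes {1..n}" for z E \<pi>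
      using scores n1(1) that
      unfolding conformity_scores_def sets_eq_imp_space_eq[OF P_sets[OF n1(1)]]
        sets_eq_imp_space_eq[OF sets_tuple, symmetric] by blast
    interpret P: prob_space "P n" by (rule P_prob[OF n1(1)])
    interpret M: prob_space "M n" by (rule M_prob[OF n1(1)])
    interpret CS: conditional_sample "P n" n "C n n" "C n (n - 1)" "M n" "t n" "K n"
        "tuple_space n ?Z" "tuple_space (n + 1) ?Z"
      by unfold_locales (fact n1(1) sc[OF n1(1)] sc[OF n1(2)] sets_tuple t_iid[OF n1(1)] K_cond[OF n1(1)]
        | rule sym; assumption)+
    have "noncoverage ?Z (Y n) (C n) n \<alpha> 0 =
        {s \<in> space (\<Pi>\<^sub>M i\<in>{1..n+1}. P n). 1 - \<alpha> \<le> CS.rel_rank s}" for \<alpha>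
      unfolding noncoverage_eq CS.rel_rank_def CS.loo_score_eq sets_eq_imp_space_eq[OF sets_tuple] ..
    then have D: "D n = (\<integral>\<omega>. CS.deviation \<omega> \<partial>M n)"
      unfolding D_def CS.deviation_def by simp
    show ?thesis
      unfolding D V_def CS.instability_eq_prob[symmetric]
      using CS.integral_deviation_nonneg
        CS.integral_deviation_le[OF f[OF n1(1)] f_meas[OF n1(1)] pos(3) q pos(1,2)] by blast
  qed

  have "D \<longlonglongrightarrow> 0"
  proof (rule LIMSEQ_I)
    fix r :: real assume r: "r > 0"
    define \<epsilon> where "\<epsilon> = r / 2"
    have \<epsilon>: "\<epsilon> > 0" using r by (simp add: \<epsilon>_def)
    define \<kappa> where "\<kappa> = \<epsilon> ^ 3"
    have \<kappa>: "\<kappa> > 0" using \<epsilon> by (simp add: \<kappa>_def)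
    have "\<exists>B. \<forall>n\<ge>1. measure (M n) {\<omega> \<in> space (M n).
        (SUP x. ennreal \<bar>f n (tuple n (t n) \<omega>) x\<bar>) > ennreal B} \<le> \<kappa> / 16"
    proof -
      have "\<kappa> / 16 > 0" using \<kappa> by simp
      then show ?thesis using f_bounded unfolding stochastically_bounded_def by blast
    qed
    then obtain B0 where B0: "\<And>n. n \<ge> 1 \<Longrightarrow> measure (M n) {\<omega> \<in> space (M n).
        (SUP x. ennreal \<bar>f n (tuple n (t n) \<omega>) x\<bar>) > ennreal B0} \<le> \<kappa> / 16" by blast
    define B where "B = max B0 0"
    have B: "B \<ge> 0" by (simp add: B_def)
    have Bq: "measure (M n) {\<omega> \<in> space (M n).
        (SUP x. ennreal \<bar>f n (tuple n (t n) \<omega>) x\<bar>) > ennreal B} \<le> \<kappa> / 16" if "n \<ge> 1" for n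
      using B0[OF that] by (cases "B0 \<ge> 0") (simp_all add: B_def max_def ennreal_neg)
    \<comment> \<open>The error terms are \<open>8 * \<delta> * B \<le> \<kappa> / 5\<close>, \<open>2 * (\<kappa> / 16)\<close> and, for large \<open>n\<close>, four times an
      instability below \<open>\<kappa> / 20\<close> and \<open>1 / (n + 1) < \<kappa> / 5\<close>; their sum is below \<open>\<kappa> = \<epsilon>\<^sup>3\<close>.\<close>
    define \<delta> where "\<delta> = \<kappa> / 40 / (B + 1)"
    have \<delta>: "\<delta> > 0" using \<kappa> B by (simp add: \<delta>_def)
    have \<delta>B: "8 * \<delta> * B \<le> \<kappa> / 5"
    proof -
      have "8 * \<delta> * B \<le> 8 * (\<delta> * (B + 1))" using \<delta> by simp
      also have "\<delta> * (B + 1) = \<kappa> / 40"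
      proof -
        have "B + 1 \<noteq> 0" using B by linarith
        then show ?thesis unfolding \<delta>_def by (metis nonzero_eq_divide_eq)
      qed
      finally show ?thesis by simp
    qed
    have "(\<lambda>n. measure (M n) {\<omega> \<in> space (M n). \<bar>V n \<omega>\<bar> > \<delta> / 2}) \<longlonglongrightarrow> 0"
    proof -
      have "\<delta> / 2 > 0" using \<delta> by simp
      then show ?thesis
        using stable unfolding stable_scores_def tends_to_0_in_probability_def V_def by blast
    qed
    then have "\<forall>\<^sub>F n in sequentially. measure (M n) {\<omega> \<in> space (M n). \<bar>V n \<omega>\<bar> > \<delta> / 2} < \<kappa> / 20"
      using \<kappa> by (intro order_tendstoD(2)) auto
    moreover have "\<forall>\<^sub>F n in sequentially. 1 / real (n + 1) < \<kappa> / 5"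
      using \<kappa> LIMSEQ_inverse_real_of_nat
      by (intro order_tendstoD(2)[of _ 0]) (simp_all add: inverse_eq_divide)
    ultimately have "\<forall>\<^sub>F n in sequentially. norm (D n - 0) < r"
      using eventually_ge_at_top[of 2]
    proof eventually_elim
      case (elim n)
      let ?X = "8 * \<delta> * B + 2 * (\<kappa> / 16) +
        4 * measure (M n) {\<omega> \<in> space (M n). \<bar>V n \<omega>\<bar> > \<delta> / 2} + 1 / real (n + 1)"
      have D: "0 \<le> D n" "D n \<le> \<epsilon> + ?X / \<epsilon>\<^sup>2"
        using bound[OF _ \<epsilon> \<delta> B Bq, of n] elim(3) by auto
      have "?X < \<kappa>" using elim \<delta>B \<kappa> by linarith
      then have "?X / \<epsilon>\<^sup>2 < \<kappa> / \<epsilon>\<^sup>2" using \<epsilon> by (intro divide_strict_right_mono) auto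
      also have "\<kappa> / \<epsilon>\<^sup>2 = \<epsilon>" using \<epsilon> by (simp add: \<kappa>_def power2_eq_square power3_eq_cube)
      finally have "D n < \<epsilon> + \<epsilon>"
        by (intro le_less_trans[OF D(2)] add_strict_left_mono)
      then show ?case using D(1) by (simp add: \<epsilon>_def)
    qed
    then show "\<exists>no. \<forall>n\<ge>no. norm (D n - 0) < r"
      by (simp add: eventually_sequentially)
  qed
  then show ?thesis unfolding D_def .
qed

end
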